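(* (1) Let $A$ be an invertible $\nu\times\nu$ matrix ($\nu\ge1$) over a field of characteristic zero and write $\operatorname{adj}(\lambda I-A)=\sum_{j=0}^{\nu-1}A_j\lambda^j$. Then $A_j\neq0$ for every $0\le j\le\nu-1$. (2) Consequently, let $n\ge3$, let $U\subset\mathbb{R}^n$ be open, $X\in C^2(U,\mathbb{R}^n)$, $p\in U$ with $X(p)=0$, $J:=DX(p)$ with $\operatorname{rank}J=n-1$, $e_{n-1}(J)=0$, $e_{n-2}(J)\ne0$, and let $q_0$ span $\ker J$. Put $\nu=n-2$, $J_{\mathrm{tr}}:=J|_{\operatorname{im}J^2}$, $\operatorname{adj}(\lambda I-J_{\mathrm{tr}})=\sum_{j=0}^{\nu-1}A_j\lambda^j$. Then for every $2\le\rho\le n-1$ the map $L_{\mathrm{tr}}\mapsto t_{\rho-2}:=\operatorname{tr}(A_{\rho-2}L_{\mathrm{tr}})$ is a nonzero linear form on the endomorphisms of $\operatorname{im}J^2$. Therefore no $D_{q_0}e_k:=\frac{d}{ds}\big|_{s=0}e_k(DX(p+sq_0))$ with $1\le k\le n-2$ is determined by $J$ and the pair $(a,b)$ of Bogdanov--Takens coefficients associated with $(X,p,q_0)$; that is, for each such $k$ there is a $C^2$ vector field $\tilde X$ with $\tilde X(p)=0$, $D\tilde X(p)=J$ and the same coefficients $(a,b)$ relative to $q_0$, but with $D_{q_0}e_k(D\tilde X)(p)\ne D_{q_0}e_k(DX)(p)$. Thus, among $e_1,\dots,e_n$, the invariants $e_{n-1}$ and $e_n$ are the only ones whose derivative $D_{q_0}e_k$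 is determined by $J$ and $(a,b)$.
   Context: For a real $m\times m$ matrix $A$, $e_k(A)$ is the sum of the principal $k\times k$ minors of $A$, so that $\det(\lambda I-A)=\sum_{k=0}^m(-1)^k e_k(A)\lambda^{m-k}$; $e_0=1$. $\operatorname{adj}$ is the adjugate. Under the stated conditions on $J$, $\mathbb{R}^n=E^c\oplus E^{\mathrm{tr}}$ with $E^c:=\ker J^2$, $E^{\mathrm{tr}}:=\operatorname{im}J^2$, both $J$-invariant, $\dim E^c=2$, $J|_{E^c}$ nilpotent of rank one, and $J_{\mathrm{tr}}=J|_{E^{\mathrm{tr}}}$ invertible. With $L:=\frac{d}{ds}\big|_{s=0}DX(p+sq_0)$, $L_{\mathrm{tr}}:=\Pi_{\mathrm{tr}}L|_{E^{\mathrm{tr}}}$, where $\Pi_{\mathrm{tr}}$ is the projection onto $E^{\mathrm{tr}}$ along $E^c$. Definition of $(a,b)$: choose $q_1\in E^c$ with $Jq_1=q_0$; let $p_0,p_1$ be the covectors determined by $\langle p_0,q_0\rangle=\langle p_1,q_1\rangle=1$, $\langle p_0,q_1\rangle=\langle p_1,q_0\rangle=0$, $p_0|_{E^{\mathrm{tr}}}=p_1|_{E^{\mathrm{tr}}}=0$. With $B(u,v):=D^2X(p)[u,v]$, $a:=\tfrac12\langle p_1,B(q_0,q_0)\rangle$ and $b:=\langle p_0,B(q_0,q_0)\rangle+\langle p_1,B(q_0,q_1)\rangle$; the pair does not depend on the choice of $q_1$. *)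

theory Defs
  imports "HOL-Analysis.Analysis" "Jordan_Normal_Form.Char_Poly"
begin

no_notation vec_index (infixl \<open>$\<close> 100)

text \<open>
  Matrices of a fixed format \<open>n \<times> n\<close> on \<open>\<real>\<^sup>n\<close> are of type \<open>real^'n^'n\<close>. Matrices of the arbitrary
  size \<open>\<nu>\<close>, in particular those representing endomorphisms of the subspace \<open>im J\<^sup>2\<close>, are of
  type \<open>'a mat\<close>.
\<close>

text \<open>\<open>adj_coeff A j\<close> is \<open>A\<^sub>j\<close> in \<open>adj (\<lambda>I - A) = \<Sum>j<\<nu>. A\<^sub>j \<lambda>\<^sup>j\<close>;
  \<^const>\<open>char_poly_matrix\<close> is the matrix \<open>\<lambda>I - A\<close> over the polynomial ring.\<close>

definition adj_coeff :: "'a::comm_ring_1 mat \<Rightarrow> nat \<Rightarrow> 'a mat" where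
  "adj_coeff A j = map_mat (\<lambda>q. coeff q j) (adj_mat (char_poly_matrix A))"

lemma adj_char_poly_matrix_expansion:
  fixes A :: "'a::comm_ring_1 mat"
  assumes A: "A \<in> carrier_mat \<nu> \<nu>" and ij: "r < \<nu>" "c < \<nu>"
  shows "adj_mat (char_poly_matrix A) $$ (r, c) = (\<Sum>j<\<nu>. monom (adj_coeff A j $$ (r, c)) j)"
proof -
  let ?C = "char_poly_matrix A"
  let ?M = "mat_delete ?C c r"
  let ?q = "adj_mat ?C $$ (r, c)"
  have C: "?C \<in> carrier_mat \<nu> \<nu>" using A by simp
  have M: "?M \<in> carrier_mat (\<nu> - 1) (\<nu> - 1)"
    using C by (simp add: mat_delete_def)
  have dC: "degree (?C $$ (i, j)) \<le> 1" if "i < \<nu>" "j < \<nu>" for i j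
    using that A by (auto simp: char_poly_matrix_def)
  have dM: "degree (?M $$ (i, j)) \<le> 1" if "i < \<nu> - 1" "j < \<nu> - 1" for i j
    using that C by (auto simp: mat_delete_def intro!: dC[simplified])
  have "degree (det ?M) \<le> 1 * (\<nu> - 1)"
    by (rule degree_det_le[OF _ M]) (use dM in auto)
  moreover have "?q = (-1) ^ (c + r) * det ?M"
    using C ij by (simp add: adj_mat_def cofactor_def)
  moreover have "degree ((-1) ^ (c + r) * det ?M) \<le> degree (det ?M)"
    by (cases "even (c + r)") auto
  ultimately have deg: "degree ?q < \<nu>" using ij by auto
  have "coeff ?q k = coeff (\<Sum>j<\<nu>. monom (coeff ?q j) j) k" for k
  proof -
    have "coeff (\<Sum>j<\<nu>. monom (coeff ?q j) j) k = (if k < \<nu> then coeff ?q k else 0)"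
      by (simp add: coeff_sum coeff_monom)
    then show ?thesis using deg by (auto intro: coeff_eq_0)
  qed
  then have "?q = (\<Sum>j<\<nu>. monom (coeff ?q j) j)" by (rule poly_eqI)
  moreover have "adj_coeff A j $$ (r, c) = coeff ?q j" for j
    using C ij by (simp add: adj_coeff_def adj_mat_def)
  ultimately show ?thesis by simp
qed

text \<open>The Leibniz formula for the submatrix with rows and columns in \<open>S\<close>; for \<open>S = UNIV\<close> it is
  the library determinant.\<close>

definition principal_minor :: "'a::comm_ring_1^'n^'n \<Rightarrow> 'n set \<Rightarrow> 'a" where
  "principal_minor A S =
     (\<Sum>\<sigma> | \<sigma> permutes S. of_int (sign \<sigma>) * (\<Prod>i\<in>S. A $ i $ \<sigma> i))"

lemma principal_minor_UNIV: "principal_minor A UNIV = Determinants.det A"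
  by (simp add: principal_minor_def Determinants.det_def)

definition e_inv :: "nat \<Rightarrow> 'a::comm_ring_1^'n^'n \<Rightarrow> 'a" where
  "e_inv k A = (\<Sum>S | card S = k. principal_minor A S)"

text \<open>An endomorphism of \<open>E\<close> is represented by a function on the whole space whose values outside
  \<open>E\<close> are irrelevant.\<close>

definition End_on :: "'v::real_vector set \<Rightarrow> ('v \<Rightarrow> 'v) set" where
  "End_on E = {f. (\<forall>x\<in>E. f x \<in> E) \<and>
                  (\<forall>x\<in>E. \<forall>y\<in>E. f (x + y) = f x + f y) \<and>
                  (\<forall>c. \<forall>x\<in>E. f (c *\<^sub>R x) = c *\<^sub>R f x)}"

text \<open>The second conjunct says that \<open>t\<close> depends only on the restriction to \<open>E\<close>.\<close>

definition linear_form_on_End :: "'v::real_vector set \<Rightarrow> (('v \<Rightarrow> 'v) \<Rightarrow> real) \<Rightarrow> bool" where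
  "linear_form_on_End E t \<longleftrightarrow>
     (\<forall>f\<in>End_on E. \<forall>g\<in>End_on E. t (\<lambda>x. f x + g x) = t f + t g) \<and>
     (\<forall>f\<in>End_on E. \<forall>g\<in>End_on E. (\<forall>x\<in>E. f x = g x) \<longrightarrow> t f = t g) \<and>
     (\<forall>c. \<forall>f\<in>End_on E. t (\<lambda>x. c *\<^sub>R f x) = c * t f)"

definition basis_list :: "'v::real_vector set \<Rightarrow> 'v list \<Rightarrow> bool" where
  "basis_list E bs \<longleftrightarrow> distinct bs \<and> independent (set bs) \<and> span (set bs) = E"

definition endo_mat :: "'v::real_vector list \<Rightarrow> ('v \<Rightarrow> 'v) \<Rightarrow> real mat" where
  "endo_mat bs f =
     Matrix.mat (length bs) (length bs) (\<lambda>(i, j). representation (set bs) (f (bs ! j)) (bs ! i))"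

definition mat_trace :: "'a::comm_monoid_add mat \<Rightarrow> 'a" where
  "mat_trace M = (\<Sum>i<dim_row M. M $$ (i, i))"

text \<open>\<open>t_form bs T j\<close> is the map \<open>M \<mapsto> tr (A\<^sub>j M)\<close>, with
  \<open>adj (\<lambda>I - T) = \<Sum>j. A\<^sub>j \<lambda>\<^sup>j\<close> computed in the basis \<open>bs\<close> of the subspace.\<close>

definition t_form :: "'v::real_vector list \<Rightarrow> ('v \<Rightarrow> 'v) \<Rightarrow> nat \<Rightarrow> ('v \<Rightarrow> 'v) \<Rightarrow> real" where
  "t_form bs T j M = mat_trace (adj_coeff (endo_mat bs T) j * endo_mat bs M)"

definition C2_on :: "'v::real_normed_vector set \<Rightarrow> ('v \<Rightarrow> 'w::real_normed_vector) \<Rightarrow> bool" where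
  "C2_on U X \<longleftrightarrow> (\<exists>(X' :: 'v \<Rightarrow> 'v \<Rightarrow>\<^sub>L 'w) (X'' :: 'v \<Rightarrow> 'v \<Rightarrow>\<^sub>L 'v \<Rightarrow>\<^sub>L 'w).
     (\<forall>x\<in>U. (X has_derivative blinfun_apply (X' x)) (at x)) \<and>
     (\<forall>x\<in>U. (X' has_derivative blinfun_apply (X'' x)) (at x)) \<and>
     continuous_on U X'')"

abbreviation DX :: "(real^'n \<Rightarrow> real^'n) \<Rightarrow> real^'n \<Rightarrow> real^'n^'n" where
  "DX X x \<equiv> jacobian X (at x)"

definition D2X :: "(real^'n \<Rightarrow> real^'n) \<Rightarrow> real^'n \<Rightarrow> real^'n \<Rightarrow> real^'n \<Rightarrow> real^'n" where
  "D2X X p u v = frechet_derivative (\<lambda>x. DX X x) (at p) u *v v"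

definition De :: "nat \<Rightarrow> (real^'n \<Rightarrow> real^'n) \<Rightarrow> real^'n \<Rightarrow> real^'n \<Rightarrow> real" where
  "De k X p q = deriv (\<lambda>s. e_inv k (DX X (p + s *\<^sub>R q))) 0"

definition mker :: "real^'n^'n \<Rightarrow> (real^'n) set" where
  "mker A = {v. A *v v = 0}"

definition E_c :: "real^'n^'n \<Rightarrow> (real^'n) set" where
  "E_c J = mker (J ** J)"

definition E_tr :: "real^'n^'n \<Rightarrow> (real^'n) set" where
  "E_tr J = range (\<lambda>v. (J ** J) *v v)"

definition BT_frame ::
  "real^'n^'n \<Rightarrow> real^'n \<Rightarrow> real^'n \<Rightarrow> (real^'n \<Rightarrow> real) \<Rightarrow> (real^'n \<Rightarrow> real) \<Rightarrow> bool" where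
  "BT_frame J q0 q1 p0 p1 \<longleftrightarrow>
     q1 \<in> E_c J \<and> J *v q1 = q0 \<and>
     linear p0 \<and> linear p1 \<and>
     p0 q0 = 1 \<and> p1 q1 = 1 \<and> p0 q1 = 0 \<and> p1 q0 = 0 \<and>
     (\<forall>v\<in>E_tr J. p0 v = 0) \<and> (\<forall>v\<in>E_tr J. p1 v = 0)"

text \<open>The pair \<open>(a, b)\<close>; it does not depend on the choice of \<open>q1\<close>, which makes the definite
  description meaningful.\<close>

definition BT_coeffs :: "(real^'n \<Rightarrow> real^'n) \<Rightarrow> real^'n \<Rightarrow> real^'n \<Rightarrow> real \<times> real" where
  "BT_coeffs X p q0 = (THE ab. \<exists>q1 p0 p1. BT_frame (DX X p) q0 q1 p0 p1 \<and>
     ab = (1/2 * p1 (D2X X p q0 q0), p0 (D2X X p q0 q0) + p1 (D2X X p q0 q1)))"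

text \<open>The value of \<open>D\<^bsub>q0\<^esub> e\<^sub>k\<close> is a function of \<open>J\<close> and \<open>(a, b)\<close> only: for given \<open>J\<close>, one
  function of \<open>(a, b)\<close> serves all vector fields, all points and all spanning vectors \<open>q0\<close>.\<close>

definition determined_by_J_ab :: "real^'n^'n \<Rightarrow> nat \<Rightarrow> bool" where
  "determined_by_J_ab J k \<longleftrightarrow>
     (\<exists>F :: real \<times> real \<Rightarrow> real. \<forall>U X p q0.
        open U \<and> C2_on U X \<and> p \<in> U \<and> X p = 0 \<and> DX X p = J \<and> span {q0} = mker J
        \<longrightarrow> De k X p q0 = F (BT_coeffs X p q0))"

end

(* In the splitting R^n = ker J^2 + im J^2, Jacobi's formula writes the derivative of
   det (x I - DX(p + s q0)) at s = 0 as - tr (adj (x I - J) L), where L is the derivative of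
   DX(p + s q0). The block on ker J^2 contributes
   - chi_tr(x) (b x + 2 a), which fixes the two lowest coefficients, those of e_n and e_(n-1). The block
   on im J^2 enters only from x^2 on, through tr (A_j L_tr), and L_tr is changed freely, with J and
   (a, b) kept, by adding to X a quadratic field l(x - p) M (x - p) with l(q0) = 1 and M living on im J^2.
   That the forms tr (A_j .) do not vanish is a trace argument: tr adj (x I - A) = chi'(x), so
   A_j = 0 makes the coefficient of x^(j+1) in chi zero, the recurrence
   A_j = A A_(j+1) + chi_(j+1) I gives A_(j+1) = 0, and so on up to A_(nu-1) = I. *)

theory Submission
  imports Defs
begin

section \<open>Coefficients of the adjugate of the characteristic matrix\<close>

text \<open>No determinant is split into blocks. With y = 1/x, the gradient of e_k at J is up to
  sign the trace pairing with \<open>fl_mat J (k - 1)\<close>, a coefficient of adj (I - y J) and a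
  polynomial in J on the whole space. The vanishing of e_(n-1) and e_n acts on the last two steps of
  its recursion: it makes \<open>D\<close>, the matrix with index n - 2, vanish on im J^2 and equal
  c2 I + c3 J on ker J^2. Inverting that polynomial modulo J^2 yields the projection onto ker J^2,
  so the splitting and the vector q1 come without a Jordan normal form. The nonvanishing argument
  occurs twice: for abstract square matrices, which serves the forms in a basis of im J^2, and for
  \<open>fl_mat J m\<close> over R^n, where traces on R^n and on ker J^2 are compared. This avoids
  transporting adjugates between a subspace and R^n. The pair (a, b) is a definite description; it
  is well defined because the derivatives of e_n and e_(n-1) do not refer to a frame.\<close>

lemma adj_coeff_carrier:
  assumes "A \<in> carrier_mat n n"
  shows "adj_coeff A j \<in> carrier_mat n n"
  using assms adj_mat(1)[of "char_poly_matrix A" n] by (auto simp: adj_coeff_def)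

lemma mult_mat_entry:
  assumes "A \<in> carrier_mat n m" "B \<in> carrier_mat m k" "r < n" "c < k"
  shows "(A * B) $$ (r, c) = (\<Sum>i<m. A $$ (r, i) * B $$ (i, c))"
  using assms by (simp add: times_mat_def scalar_prod_def atLeast0LessThan)

text \<open>On the diagonal the cofactor sign is +1, so the entries are the characteristic
  polynomials of the matrices with row and column i deleted; these sum to the derivative.\<close>

lemma trace_adj_char_poly_matrix:
  fixes A :: "'a::idom mat"
  assumes A: "A \<in> carrier_mat n n"
  shows "(\<Sum>i<n. adj_mat (char_poly_matrix A) $$ (i, i)) = pderiv (char_poly A)"
proof -
  have "adj_mat (char_poly_matrix A) $$ (i, i) = char_poly (mat_delete A i i)" if "i < n" for i
  proof -
    have "mat_delete (char_poly_matrix A) i i = char_poly_matrix (mat_delete A i i)"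
      using A that by (intro eq_matI) (auto simp: mat_delete_def char_poly_matrix_def)
    then show ?thesis
      using that carrier_matD[OF char_poly_matrix_closed[OF A]]
      by (simp add: adj_mat_def cofactor_def char_poly_def)
  qed
  then show ?thesis
    by (simp add: pderiv_char_poly[OF A])
qed

lemma trace_adj_coeff:
  fixes A :: "'a::idom mat"
  assumes A: "A \<in> carrier_mat n n"
  shows "(\<Sum>i<n. adj_coeff A j $$ (i, i)) = of_nat (Suc j) * coeff (char_poly A) (Suc j)"
proof -
  have "(\<Sum>i<n. adj_coeff A j $$ (i, i)) = coeff (\<Sum>i<n. adj_mat (char_poly_matrix A) $$ (i, i)) j"
    using A adj_mat(1)[of "char_poly_matrix A" n] by (simp add: adj_coeff_def coeff_sum)
  then show ?thesis
    by (simp add: trace_adj_char_poly_matrix[OF A] coeff_pderiv)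
qed

text \<open>Comparison of the coefficients of x^(j+1) in (x I - A) adj (x I - A) = chi I; the factor
  x shifts \<open>Suc j\<close> down to \<open>j\<close>.\<close>

lemma adj_coeff_recurrence:
  fixes A :: "'a::comm_ring_1 mat"
  assumes A: "A \<in> carrier_mat n n" and rc: "r < n" "c < n"
  shows "adj_coeff A j $$ (r, c) =
    (A * adj_coeff A (Suc j)) $$ (r, c) + (if r = c then coeff (char_poly A) (Suc j) else 0)"
proof -
  let ?C = "char_poly_matrix A"
  have C: "?C \<in> carrier_mat n n" using A by simp
  have adj: "adj_mat ?C \<in> carrier_mat n n" using adj_mat(1)[OF C] .
  have "(?C * adj_mat ?C) $$ (r, c) = (Determinant.det ?C \<cdot>\<^sub>m 1\<^sub>m n) $$ (r, c)"
    using adj_mat(2)[OF C] by simp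
  then have "(\<Sum>i<n. ?C $$ (r, i) * adj_mat ?C $$ (i, c)) = (if r = c then char_poly A else 0)"
    using rc by (simp add: mult_mat_entry[OF C adj rc] char_poly_def)
  from arg_cong[OF this, of "\<lambda>q. coeff q (Suc j)"]
  have *: "(\<Sum>i<n. coeff (?C $$ (r, i) * adj_mat ?C $$ (i, c)) (Suc j)) =
      (if r = c then coeff (char_poly A) (Suc j) else 0)"
    by (cases "r = c") (simp_all only: coeff_sum coeff_0 if_True if_False simp_thms)
  have "coeff (?C $$ (r, i) * adj_mat ?C $$ (i, c)) (Suc j) =
      (if i = r then adj_coeff A j $$ (r, c) else 0) - A $$ (r, i) * adj_coeff A (Suc j) $$ (i, c)"
    if "i < n" for i
    using that rc A adj
    by (auto simp: char_poly_matrix_def adj_coeff_def algebra_simps)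
  then have "(\<Sum>i<n. coeff (?C $$ (r, i) * adj_mat ?C $$ (i, c)) (Suc j)) =
      (\<Sum>i<n. (if i = r then adj_coeff A j $$ (r, c) else 0) - A $$ (r, i) * adj_coeff A (Suc j) $$ (i, c))"
    by (intro sum.cong) auto
  also have "\<dots> = adj_coeff A j $$ (r, c) - (A * adj_coeff A (Suc j)) $$ (r, c)"
    using rc A adj_coeff_carrier[OF A, of "Suc j"]
    by (simp add: sum_subtractf mult_mat_entry[OF A adj_coeff_carrier[OF A] rc])
  finally show ?thesis using * by (simp add: algebra_simps)
qed

text \<open>Characteristic zero enters through the division by j + 1 in the trace identity,
  invertibility through the cancellation of A in A A_(j+1) = 0.\<close>

lemma adj_coeff_eq_0_Suc:
  fixes A :: "'a::field_char_0 mat"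
  assumes A: "A \<in> carrier_mat n n" and inv: "invertible_mat A"
    and 0: "adj_coeff A j = 0\<^sub>m n n"
  shows "adj_coeff A (Suc j) = 0\<^sub>m n n \<and> coeff (char_poly A) (Suc j) = 0"
proof -
  let ?A' = "adj_coeff A (Suc j)"
  have A': "?A' \<in> carrier_mat n n" by (rule adj_coeff_carrier[OF A])
  have "of_nat (Suc j) * coeff (char_poly A) (Suc j) = 0"
    using trace_adj_coeff[OF A, of j] 0 by simp
  then have c: "coeff (char_poly A) (Suc j) = 0"
    by (metis mult_eq_0_iff of_nat_eq_0_iff nat.distinct(1))
  have AA': "A * ?A' = 0\<^sub>m n n"
  proof (rule eq_matI)
    fix r s assume "r < dim_row (0\<^sub>m n n :: 'a mat)" "s < dim_col (0\<^sub>m n n :: 'a mat)"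
    then show "(A * ?A') $$ (r, s) = 0\<^sub>m n n $$ (r, s)"
      using adj_coeff_recurrence[OF A, of r s j] by (cases "r = s") (simp_all add: 0 c del: index_mult_mat)
  qed (use A A' in auto)
  obtain B where B: "A * B = 1\<^sub>m n" "B * A = 1\<^sub>m (dim_row B)"
    using inv A by (auto simp: invertible_mat_def inverts_mat_def)
  have Bc: "B \<in> carrier_mat n n"
    using B A by (metis carrier_matD carrier_matI index_mult_mat(2,3) index_one_mat(2,3))
  have "?A' = (B * A) * ?A'" using B A' Bc by simp
  also have "\<dots> = B * (A * ?A')" by (rule assoc_mult_mat[OF Bc A A'])
  also have "\<dots> = 0\<^sub>m n n" using AA' Bc by simp
  finally show ?thesis using c by simp
qed

lemma adj_coeff_nonzero:
  fixes A :: "'a::field_char_0 mat"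
  assumes A: "A \<in> carrier_mat n n" and inv: "invertible_mat A" and j: "j < n"
  shows "adj_coeff A j \<noteq> 0\<^sub>m n n"
proof
  assume 0: "adj_coeff A j = 0\<^sub>m n n"
  have "adj_coeff A (j + i) = 0\<^sub>m n n \<and> coeff (char_poly A) (Suc (j + i)) = 0" for i
    by (induction i) (use 0 adj_coeff_eq_0_Suc[OF A inv] in auto)
  \<comment> \<open>The chain ends at the leading coefficient: i = n - 1 - j would make coefficient
    n of the monic \<open>char_poly A\<close> zero.\<close>
  from this[of "n - Suc j"] j have "coeff (char_poly A) n = 0" by simp
  then show False
    using degree_monic_char_poly[OF A] by simp
qed

section \<open>Trace forms on endomorphisms of a subspace\<close>

text \<open>Elements of \<open>End_on E\<close> are additive and homogeneous only on E, so the
  induction also has to keep the partial sums in E.\<close>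

lemma End_on_sum:
  fixes n :: nat
  assumes f: "f \<in> End_on E" and E: "subspace E" and x: "\<And>i. i < n \<Longrightarrow> x i \<in> E"
  shows "f (\<Sum>i<n. c i *\<^sub>R x i) = (\<Sum>i<n. c i *\<^sub>R f (x i))"
  using x
proof (induction n)
  case 0
  have "f (0 *\<^sub>R 0) = 0 *\<^sub>R f 0" using f subspace_0[OF E] unfolding End_on_def by blast
  then show ?case by simp
next
  case (Suc n)
  have "(\<Sum>i<n. c i *\<^sub>R x i) \<in> E" "c n *\<^sub>R x n \<in> E" "x n \<in> E"
    using Suc.prems by (auto intro!: subspace_sum subspace_scale E)
  then have "f ((\<Sum>i<n. c i *\<^sub>R x i) + c n *\<^sub>R x n) = f (\<Sum>i<n. c i *\<^sub>R x i) + c n *\<^sub>R f (x n)"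
    using f unfolding End_on_def by simp
  then show ?case using Suc by simp
qed

context
  fixes E :: "'v::real_vector set" and bs :: "'v list"
  assumes basis: "basis_list E bs"
begin

lemma basis_listD:
  shows "independent (set bs)" "span (set bs) = E" "subspace E" "distinct bs"
  using basis subspace_span by (auto simp: basis_list_def)

lemma nth_basis: "i < length bs \<Longrightarrow> bs ! i \<in> E"
  using basis_listD(2) span_base nth_mem by metis

lemma representation_nth:
  assumes "i < length bs" "j < length bs"
  shows "representation (set bs) (bs ! i) (bs ! j) = (if i = j then 1 else 0)"
  using assms basis_listD
  by (simp add: real_vector.representation_basis nth_eq_iff_index_eq)

lemma basis_expansion_nth:
  assumes "v \<in> E"
  shows "(\<Sum>i<length bs. representation (set bs) v (bs ! i) *\<^sub>R (bs ! i)) = v"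
proof -
  have "(\<Sum>i<length bs. representation (set bs) v (bs ! i) *\<^sub>R (bs ! i)) =
      (\<Sum>b\<in>set bs. representation (set bs) v b *\<^sub>R b)"
    using basis_listD(4)
    by (intro sum.reindex_bij_betw[of "\<lambda>i. bs ! i" "{..<length bs}" "set bs"]) (rule bij_betw_nth; simp)
  also have "\<dots> = v"
    using basis_listD assms by (intro real_vector.sum_representation_eq) auto
  finally show ?thesis .
qed

lemma endo_mat_carrier: "endo_mat bs f \<in> carrier_mat (length bs) (length bs)"
  by (simp add: endo_mat_def)

lemma endo_mat_compose:
  assumes f: "f \<in> End_on E" and g: "g \<in> End_on E"
  shows "endo_mat bs (\<lambda>x. f (g x)) = endo_mat bs f * endo_mat bs g"
proof (rule eq_matI)
  fix i j
  assume "i < dim_row (endo_mat bs f * endo_mat bs g)" "j < dim_col (endo_mat bs f * endo_mat bs g)"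
  then have ij: "i < length bs" "j < length bs" by (simp_all add: endo_mat_def)
  have gE: "g (bs ! j) \<in> E" using g nth_basis[OF ij(2)] by (auto simp: End_on_def)
  have fE: "f (bs ! l) \<in> E" if "l < length bs" for l
    using f nth_basis[OF that] by (auto simp: End_on_def)
  let ?r = "\<lambda>v i. representation (set bs) v (bs ! i)"
  have "f (g (bs ! j)) = f (\<Sum>l<length bs. ?r (g (bs ! j)) l *\<^sub>R (bs ! l))"
    by (simp add: basis_expansion_nth[OF gE])
  also have "\<dots> = (\<Sum>l<length bs. ?r (g (bs ! j)) l *\<^sub>R f (bs ! l))"
    by (rule End_on_sum[OF f basis_listD(3)]) (rule nth_basis)
  finally have *: "f (g (bs ! j)) = (\<Sum>l<length bs. ?r (g (bs ! j)) l *\<^sub>R f (bs ! l))" .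
  have "?r (f (g (bs ! j))) i = (\<Sum>l<length bs. ?r (g (bs ! j)) l * ?r (f (bs ! l)) i)"
    unfolding * using fE basis_listD(1-3)
    by (subst real_vector.representation_sum, simp_all add: subspace_scale)
      (auto intro!: sum.cong simp: real_vector.representation_scale)
  then show "endo_mat bs (\<lambda>x. f (g x)) $$ (i, j) = (endo_mat bs f * endo_mat bs g) $$ (i, j)"
    using ij
    by (simp add: mult_mat_entry[OF endo_mat_carrier endo_mat_carrier] del: index_mult_mat)
      (simp add: endo_mat_def mult.commute)
qed (simp_all add: endo_mat_def)

lemma endo_mat_identity:
  assumes "\<And>v. v \<in> E \<Longrightarrow> f v = v"
  shows "endo_mat bs f = 1\<^sub>m (length bs)"
  by (rule eq_matI) (auto simp: endo_mat_def assms nth_basis representation_nth)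

lemma invertible_endo_mat:
  assumes f: "f \<in> End_on E" and g: "g \<in> End_on E"
    and fg: "\<And>v. v \<in> E \<Longrightarrow> f (g v) = v" and gf: "\<And>v. v \<in> E \<Longrightarrow> g (f v) = v"
  shows "invertible_mat (endo_mat bs f)"
proof -
  have "endo_mat bs f * endo_mat bs g = 1\<^sub>m (length bs)" "endo_mat bs g * endo_mat bs f = 1\<^sub>m (length bs)"
    using endo_mat_compose[OF f g] endo_mat_compose[OF g f]
      endo_mat_identity[of "\<lambda>x. f (g x)"] endo_mat_identity[of "\<lambda>x. g (f x)"] fg gf by auto
  then show ?thesis
    by (auto simp: invertible_mat_def inverts_mat_def endo_mat_def intro!: exI[of _ "endo_mat bs g"])
qed

text \<open>As a double sum of coordinates the form is visibly linear in M and sees M only through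
  its values on the basis vectors.\<close>

lemma t_form_eq_sum:
  "t_form bs T j M = (\<Sum>i<length bs. \<Sum>l<length bs.
    adj_coeff (endo_mat bs T) j $$ (i, l) * representation (set bs) (M (bs ! i)) (bs ! l))"
proof -
  let ?A = "adj_coeff (endo_mat bs T) j"
  have A: "?A \<in> carrier_mat (length bs) (length bs)"
    by (rule adj_coeff_carrier[OF endo_mat_carrier])
  have "t_form bs T j M = (\<Sum>i<length bs. (?A * endo_mat bs M) $$ (i, i))"
    using A by (simp add: t_form_def mat_trace_def del: index_mult_mat(1))
  also have "\<dots> = (\<Sum>i<length bs. \<Sum>l<length bs. ?A $$ (i, l) * endo_mat bs M $$ (l, i))"
    by (intro sum.cong refl mult_mat_entry[OF A endo_mat_carrier]) auto
  finally show ?thesis by (simp add: endo_mat_def)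
qed

lemma linear_form_t_form: "linear_form_on_End E (t_form bs T j)"
proof -
  have rep: "representation (set bs) (f (bs ! i) + g (bs ! i)) (bs ! l) =
      representation (set bs) (f (bs ! i)) (bs ! l) + representation (set bs) (g (bs ! i)) (bs ! l)"
    "representation (set bs) (c *\<^sub>R f (bs ! i)) (bs ! l) = c * representation (set bs) (f (bs ! i)) (bs ! l)"
    if "f \<in> End_on E" "g \<in> End_on E" "i < length bs" for f g i l c
  proof -
    have "f (bs ! i) \<in> E" "g (bs ! i) \<in> E" using that nth_basis by (auto simp: End_on_def)
    then show "representation (set bs) (f (bs ! i) + g (bs ! i)) (bs ! l) =
      representation (set bs) (f (bs ! i)) (bs ! l) + representation (set bs) (g (bs ! i)) (bs ! l)"
      "representation (set bs) (c *\<^sub>R f (bs ! i)) (bs ! l) = c * representation (set bs) (f (bs ! i)) (bs ! l)"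
      using basis_listD(1,2) by (simp_all add: real_vector.representation_add real_vector.representation_scale)
  qed
  show ?thesis
    unfolding linear_form_on_End_def t_form_eq_sum
    using nth_basis
    by (auto simp: rep sum.distrib sum_distrib_left algebra_simps)
qed

lemma t_form_nonzero:
  assumes inv: "invertible_mat (endo_mat bs T)" and j: "j < length bs"
  shows "\<exists>M\<in>End_on E. t_form bs T j M \<noteq> 0"
proof -
  let ?A = "adj_coeff (endo_mat bs T) j"
  have "?A \<noteq> 0\<^sub>m (length bs) (length bs)"
    by (rule adj_coeff_nonzero[OF endo_mat_carrier inv j])
  then obtain r c where rc: "r < length bs" "c < length bs" "?A $$ (r, c) \<noteq> 0"
    using adj_coeff_carrier[OF endo_mat_carrier, of T j]
    by (metis carrier_matD eq_matI index_zero_mat)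
  \<comment> \<open>M sends the r-th basis vector to the c-th and kills the others, so the trace
    picks out the single entry (r, c).\<close>
  define M where "M v = representation (set bs) v (bs ! r) *\<^sub>R bs ! c" for v
  have "M \<in> End_on E"
    using basis_listD nth_basis[OF rc(2)]
    by (auto simp: End_on_def M_def real_vector.representation_add real_vector.representation_scale
        subspace_scale scaleR_add_left)
  moreover have "t_form bs T j M = ?A $$ (r, c)"
  proof -
    have "representation (set bs) (M (bs ! i)) (bs ! l) = (if i = r \<and> l = c then 1 else 0)"
      if "i < length bs" "l < length bs" for i l
      using that rc basis_listD nth_basis[OF rc(2)]
      by (auto simp: M_def representation_nth real_vector.representation_zero)
    then have "t_form bs T j M = (\<Sum>i<length bs. \<Sum>l<length bs. if i = r \<and> l = c then ?A $$ (i, l) else 0)"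
      unfolding t_form_eq_sum by (intro sum.cong) auto
    also have "\<dots> = (\<Sum>i<length bs. if i = r then ?A $$ (r, c) else 0)"
      using rc by (intro sum.cong) auto
    finally show ?thesis using rc by simp
  qed
  ultimately show ?thesis using rc(3) by (intro bexI[of _ M]) auto
qed

end

section \<open>Gradients of the principal minor sums\<close>

lemma principal_minor_scaleR:
  fixes A :: "real^'n^'n"
  shows "principal_minor (c *\<^sub>R A) S = c ^ card S * principal_minor A S"
  by (simp add: principal_minor_def prod.distrib sum_distrib_left algebra_simps)

lemma e_inv_scaleR:
  fixes A :: "real^'n^'n"
  shows "e_inv k (c *\<^sub>R A) = c ^ k * e_inv k A"
  by (simp add: e_inv_def principal_minor_scaleR sum_distrib_left)

lemma e_inv_0: "e_inv 0 (A :: 'a::comm_ring_1^'n^'n) = 1"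
proof -
  have "{S :: 'n set. card S = 0} = {{}}" by auto
  then show ?thesis by (simp add: e_inv_def principal_minor_def)
qed

lemma e_inv_1: "e_inv 1 (A :: 'a::comm_ring_1^'n^'n) = trace A"
proof -
  have S: "{S :: 'n set. card S = 1} = (\<lambda>i. {i}) ` UNIV"
    by (auto simp: card_1_singleton_iff)
  have "e_inv 1 A = (\<Sum>i\<in>UNIV. principal_minor A {i})"
    unfolding e_inv_def S by (subst sum.reindex) auto
  then show ?thesis
    by (simp add: principal_minor_def trace_def)
qed

lemma e_inv_CARD: "e_inv CARD('n) (A :: 'a::comm_ring_1^'n^'n) = Determinants.det A"
proof -
  have "{S :: 'n set. card S = CARD('n)} = {UNIV}"
    using card_subset_eq[of "UNIV :: 'n set"] by auto
  then show ?thesis by (simp add: e_inv_def principal_minor_UNIV)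
qed

text \<open>Expand the product over i by choosing the factor from A for i in S and from I elsewhere.
  The factors from I leave exactly the permutations that fix the complement of S, hence the Leibniz
  sum of the principal minor on S.\<close>

lemma det_1_plus:
  "Determinants.det (Finite_Cartesian_Product.mat 1 + A :: 'a::comm_ring_1^'n^'n)
    = (\<Sum>k\<le>CARD('n). e_inv k A)"
proof -
  let ?\<delta> = "\<lambda>i j :: 'n. if i = j then 1 else 0 :: 'a"
  have perm: "{\<sigma>. \<sigma> permutes (UNIV :: 'n set) \<and> (\<forall>i. i \<notin> S \<longrightarrow> i = \<sigma> i)} = {\<sigma>. \<sigma> permutes S}" for S
    by (auto simp: permutes_def)
  have "Determinants.det (Finite_Cartesian_Product.mat 1 + A) =
      (\<Sum>\<sigma> | \<sigma> permutes UNIV. of_int (sign \<sigma>) * (\<Prod>i\<in>UNIV. A $ i $ \<sigma> i + ?\<delta> i (\<sigma> i)))"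
    by (simp add: Determinants.det_def Finite_Cartesian_Product.mat_def add.commute)
  also have "\<dots> = (\<Sum>\<sigma> | \<sigma> permutes UNIV. \<Sum>S\<in>UNIV.
      of_int (sign \<sigma>) * ((\<Prod>i\<in>S. A $ i $ \<sigma> i) * (\<Prod>i\<in>UNIV - S. ?\<delta> i (\<sigma> i))))"
    by (simp add: prod_add sum_distrib_left)
  also have "\<dots> = (\<Sum>S\<in>UNIV. \<Sum>\<sigma> | \<sigma> permutes UNIV.
      of_int (sign \<sigma>) * ((\<Prod>i\<in>S. A $ i $ \<sigma> i) * (\<Prod>i\<in>UNIV - S. ?\<delta> i (\<sigma> i))))"
    by (rule sum.swap)
  also have "\<dots> = (\<Sum>S\<in>UNIV. principal_minor A S)"
  proof (rule sum.cong)
    fix S :: "'n set"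
    have "(\<Prod>i\<in>UNIV - S. ?\<delta> i (\<sigma> i)) = (if \<forall>i. i \<notin> S \<longrightarrow> i = \<sigma> i then 1 else 0)" for \<sigma>
      by (auto intro!: prod_zero)
    then have "(\<Sum>\<sigma> | \<sigma> permutes UNIV.
        of_int (sign \<sigma>) * ((\<Prod>i\<in>S. A $ i $ \<sigma> i) * (\<Prod>i\<in>UNIV - S. ?\<delta> i (\<sigma> i)))) =
      (\<Sum>\<sigma> | \<sigma> permutes UNIV.
        if \<forall>i. i \<notin> S \<longrightarrow> i = \<sigma> i then of_int (sign \<sigma>) * (\<Prod>i\<in>S. A $ i $ \<sigma> i) else 0)"
      by (intro sum.cong) auto
    also have "\<dots> = (\<Sum>\<sigma> \<in> {\<sigma>. \<sigma> permutes UNIV \<and> (\<forall>i. i \<notin> S \<longrightarrow> i = \<sigma> i)}.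
        of_int (sign \<sigma>) * (\<Prod>i\<in>S. A $ i $ \<sigma> i))"
      by (subst sum.inter_filter[symmetric]) (auto simp: finite_permutations)
    finally show "(\<Sum>\<sigma> | \<sigma> permutes UNIV.
        of_int (sign \<sigma>) * ((\<Prod>i\<in>S. A $ i $ \<sigma> i) * (\<Prod>i\<in>UNIV - S. ?\<delta> i (\<sigma> i)))) =
      principal_minor A S"
      unfolding perm by (simp add: principal_minor_def)
  qed simp
  also have "\<dots> = (\<Sum>k\<le>CARD('n). \<Sum>S | S \<in> UNIV \<and> card S = k. principal_minor A S)"
    by (rule sum.group[symmetric]) (auto intro: card_mono)
  finally show ?thesis by (simp add: e_inv_def)
qed

lemma det_1_plus_scaleR:
  fixes A :: "real^'n^'n"
  shows "Determinants.det (Finite_Cartesian_Product.mat 1 + y *\<^sub>R A)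
    = (\<Sum>k\<le>CARD('n). y ^ k * e_inv k A)"
  by (simp add: det_1_plus e_inv_scaleR)

lemma differentiable_e_inv:
  fixes A :: "real^'n^'n"
  shows "e_inv k differentiable (at A)"
proof -
  have "(\<lambda>A :: real^'n^'n. \<Prod>i\<in>S. A $ i $ \<sigma> i) differentiable (at A)" for S and \<sigma> :: "'n \<Rightarrow> 'n"
  proof -
    have "((\<lambda>A :: real^'n^'n. \<Prod>i\<in>S. A $ i $ \<sigma> i) has_derivative
        (\<lambda>L. \<Sum>i\<in>S. L $ i $ \<sigma> i * (\<Prod>j\<in>S - {i}. A $ j $ \<sigma> j))) (at A)"
      by (intro has_derivative_prod bounded_linear.has_derivative[OF bounded_linear_vec_nth]
          has_derivative_ident)
    then show ?thesis by (auto simp: differentiable_def)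
  qed
  then show ?thesis
    unfolding e_inv_def principal_minor_def
    by (intro differentiable_sum differentiable_mult ballI) auto
qed

section \<open>Derivatives of the invariants e_k along lines and curves\<close>

abbreviation dE :: "nat \<Rightarrow> real^'n^'n \<Rightarrow> real^'n^'n \<Rightarrow> real" where
  "dE k A \<equiv> frechet_derivative (e_inv k) (at A)"

lemma has_derivative_e_inv: "(e_inv k has_derivative dE k A) (at A)"
  using differentiable_e_inv frechet_derivative_works by blast

lemma linear_dE: "linear (dE k A)"
  using has_derivative_e_inv has_derivative_linear by blast

lemma has_field_derivative_e_inv_curve:
  assumes "(g has_vector_derivative L) (at t)"
  shows "((\<lambda>s. e_inv k (g s)) has_real_derivative dE k (g t) L) (at t)"
proof -
  have "((\<lambda>s. e_inv k (g s)) has_derivative (\<lambda>x. dE k (g t) (x *\<^sub>R L))) (at t)"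
    using has_derivative_compose[OF assms[unfolded has_vector_derivative_def] has_derivative_e_inv] .
  then show ?thesis
    by (simp add: linear_cmul[OF linear_dE] has_field_derivative_def mult_commute_abs)
qed

lemma e_inv_line_derivative:
  "((\<lambda>s. e_inv k (A + s *\<^sub>R L)) has_real_derivative dE k A L) (at 0)"
proof -
  have "((\<lambda>s. A + s *\<^sub>R L) has_vector_derivative L) (at 0)"
    by (auto intro!: derivative_eq_intros)
  from has_field_derivative_e_inv_curve[OF this] show ?thesis by simp
qed

text \<open>Euler's identity, from e_k((1 + s) A) = (1 + s)^k e_k(A). It later turns gradients into
  traces of \<open>fl_mat\<close>.\<close>

lemma dE_Euler: "dE k A A = of_nat k * e_inv k A"
proof -
  have "((\<lambda>s. e_inv k (A + s *\<^sub>R A)) has_real_derivative of_nat k * e_inv k A) (at 0)"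
  proof -
    have "e_inv k (A + s *\<^sub>R A) = (1 + s) ^ k * e_inv k A" for s
      by (metis e_inv_scaleR scaleR_left_distrib scaleR_one)
    then show ?thesis by (auto intro!: derivative_eq_intros)
  qed
  then show ?thesis using e_inv_line_derivative DERIV_unique by blast
qed

section \<open>Bilinearity of the matrix product, and the trace pairing\<close>

lemma matrix_scaleR_right: "A ** (c *\<^sub>R B) = c *\<^sub>R (A ** B)"
  for A :: "real^'m^'n" and B :: "real^'k^'m"
  by (simp add: Finite_Cartesian_Product.vec_eq_iff matrix_matrix_mult_def sum_distrib_left algebra_simps)

lemma matrix_scaleR_left: "(c *\<^sub>R A) ** B = c *\<^sub>R (A ** B)"
  for A :: "real^'m^'n" and B :: "real^'k^'m"
  by (simp add: Finite_Cartesian_Product.vec_eq_iff matrix_matrix_mult_def sum_distrib_left algebra_simps)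

lemma matrix_add_rdistrib: "(A + B) ** C = A ** C + B ** C"
  for A B :: "real^'m^'n" and C :: "real^'k^'m"
  by (simp add: Finite_Cartesian_Product.vec_eq_iff matrix_matrix_mult_def sum.distrib algebra_simps)

lemma matrix_sub_rdistrib: "(A - B) ** C = A ** C - B ** C"
  for A B :: "real^'m^'n" and C :: "real^'k^'m"
  by (simp add: Finite_Cartesian_Product.vec_eq_iff matrix_matrix_mult_def sum_subtractf algebra_simps)

lemma matrix_sub_ldistrib: "A ** (B - C) = A ** B - A ** C"
  for A :: "real^'m^'n" and B C :: "real^'k^'m"
  by (simp add: Finite_Cartesian_Product.vec_eq_iff matrix_matrix_mult_def sum_subtractf algebra_simps)

lemma matrix_sum_right: "A ** sum f I = (\<Sum>i\<in>I. A ** f i)"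
  for A :: "real^'m^'n" and f :: "'i \<Rightarrow> real^'k^'m"
  by (induction I rule: infinite_finite_induct) (simp_all add: matrix_add_ldistrib)

lemma trace_scaleR: "trace (c *\<^sub>R A) = c * trace A" for A :: "real^'n^'n"
  by (simp add: trace_def sum_distrib_left)

text \<open>Jacobi's formula at an invertible point: B is factored out, and the coefficient of s in
  det (I + s C L) is e_1, the trace.\<close>

lemma det_line_derivative:
  fixes B L :: "real^'n^'n"
  assumes inv: "B ** C = Finite_Cartesian_Product.mat 1"
  shows "((\<lambda>s. Determinants.det (B + s *\<^sub>R L)) has_real_derivative
    Determinants.det B * trace (C ** L)) (at 0)"
proof -
  let ?M = "C ** L"
  have BM: "B ** ?M = L"
    using inv by (simp add: matrix_mul_assoc)
  have "Determinants.det (B + s *\<^sub>R L) =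
      Determinants.det B * (\<Sum>k\<le>CARD('n). s ^ k * e_inv k ?M)" for s
  proof -
    have "B + s *\<^sub>R L = B ** (Finite_Cartesian_Product.mat 1 + s *\<^sub>R ?M)"
      by (simp add: matrix_add_ldistrib BM matrix_scaleR_right)
    then show ?thesis by (simp add: det_mul det_1_plus_scaleR)
  qed
  moreover have "((\<lambda>s. Determinants.det B * (\<Sum>k\<le>CARD('n). s ^ k * e_inv k ?M)) has_real_derivative
      Determinants.det B * (\<Sum>k\<le>CARD('n). (of_nat k * 0 ^ (k - 1)) * e_inv k ?M)) (at 0)"
    by (auto intro!: derivative_eq_intros)
  \<comment> \<open>Only k = 1 survives: at k = 0 the power is 0 ^ 0 = 1, but the factor k is
    zero.\<close>
  moreover have "(\<Sum>k\<le>CARD('n). (of_nat k * 0 ^ (k - 1)) * e_inv k ?M) =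
      (\<Sum>k\<in>{1::nat}. (of_nat k * 0 ^ (k - 1)) * e_inv k ?M)"
    by (rule sum.mono_neutral_right) (auto simp: power_0_left Suc_le_eq)
  ultimately show ?thesis by (simp add: e_inv_1 del: One_nat_def)
qed

text \<open>Testing with the transpose of M gives the squared norm of M.\<close>

lemma trace_eq_0_iff:
  fixes M :: "real^'n^'n"
  assumes "\<And>L. trace (M ** L) = 0"
  shows "M = 0"
proof -
  have "trace (M ** Finite_Cartesian_Product.transpose M) = M \<bullet> M"
    by (simp add: trace_def matrix_matrix_mult_def Finite_Cartesian_Product.transpose_def inner_vec_def)
  then show ?thesis using assms by simp
qed

text \<open>Riesz representation; a transpose turns the Euclidean inner product of matrices into the
  trace pairing.\<close>

lemma linear_eq_trace:
  fixes f :: "real^'n^'n \<Rightarrow> real"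
  assumes "linear f"
  obtains G where "\<And>L. f L = trace (G ** L)"
proof
  fix L :: "real^'n^'n"
  let ?G = "\<Sum>b\<in>Basis. f b *\<^sub>R b :: real^'n^'n"
  have "trace (Finite_Cartesian_Product.transpose ?G ** L) = (\<Sum>i\<in>UNIV. \<Sum>j\<in>UNIV. ?G $ j $ i * L $ j $ i)"
    by (simp add: trace_def matrix_matrix_mult_def Finite_Cartesian_Product.transpose_def)
  also have "\<dots> = (\<Sum>j\<in>UNIV. \<Sum>i\<in>UNIV. ?G $ j $ i * L $ j $ i)"
    by (rule sum.swap)
  also have "\<dots> = ?G \<bullet> L"
    by (simp only: inner_vec_def inner_real_def)
  also have "\<dots> = (\<Sum>b\<in>Basis. (L \<bullet> b) * f b)"
    by (simp add: inner_sum_left inner_sum_right inner_commute mult.commute)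
  also have "\<dots> = f (\<Sum>b\<in>Basis. (L \<bullet> b) *\<^sub>R b)"
    by (simp add: linear_sum[OF assms] linear_cmul[OF assms])
  also have "\<dots> = f L" by (simp add: euclidean_representation)
  finally show "f L = trace (Finite_Cartesian_Product.transpose ?G ** L)" by simp
qed

section \<open>Comparison of coefficients and the Faddeev-LeVerrier recursion\<close>

lemma poly_coeffs_eq_0:
  fixes V :: "nat \<Rightarrow> real^'n^'m"
  assumes inf: "infinite Y" and 0: "\<And>y. y \<in> Y \<Longrightarrow> (\<Sum>k\<le>n. y ^ k *\<^sub>R V k) = 0" and k: "k \<le> n"
  shows "V k = 0"
proof -
  have "V k $ i $ j = 0" for i j
  proof (rule ccontr)
    assume "V k $ i $ j \<noteq> 0"
    then have "finite {y. (\<Sum>k\<le>n. V k $ i $ j * y ^ k) = 0}"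
      using polyfun_finite_roots[of "\<lambda>k. V k $ i $ j" n] k by blast
    moreover have "(\<Sum>k\<le>n. V k $ i $ j * y ^ k) = 0" if "y \<in> Y" for y
    proof -
      have "(\<Sum>k\<le>n. V k $ i $ j * y ^ k) = (\<Sum>k\<le>n. y ^ k *\<^sub>R V k) $ i $ j"
        by (simp add: mult.commute)
      then show ?thesis using 0[OF that] by simp
    qed
    ultimately show False using inf by (metis (mono_tags, lifting) finite_subset mem_Collect_eq subsetI)
  qed
  then show ?thesis by (simp add: Finite_Cartesian_Product.vec_eq_iff)
qed

text \<open>The Faddeev-LeVerrier matrices: for k < n, \<open>fl_mat A k\<close> is the coefficient
  of y^k in adj (I - y A), hence of x^(n-1-k) in adj (x I - A).\<close>

primrec fl_mat :: "real^'n^'n \<Rightarrow> nat \<Rightarrow> real^'n^'n" where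
  "fl_mat A 0 = Finite_Cartesian_Product.mat 1"
| "fl_mat A (Suc k) = A ** fl_mat A k + ((- 1) ^ Suc k * e_inv (Suc k) A) *\<^sub>R Finite_Cartesian_Product.mat 1"

text \<open>The determinant is a polynomial in y with constant term e_0 = 1, so it has finitely many
  zeros. Jacobi's formula holds off these zeros, which leaves enough values of y to compare
  coefficients.\<close>

lemma infinite_invertible_1_minus:
  fixes A :: "real^'n^'n"
  shows "infinite {y. y \<noteq> 0 \<and> Determinants.det (Finite_Cartesian_Product.mat 1 - y *\<^sub>R A) \<noteq> 0}"
    (is "infinite ?Y")
proof
  assume fin: "finite ?Y"
  have det: "Determinants.det (Finite_Cartesian_Product.mat 1 - y *\<^sub>R A) =
      (\<Sum>k\<le>CARD('n). ((- 1) ^ k * e_inv k A) * y ^ k)" for y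
    using det_1_plus_scaleR[of "- y" A] by (simp add: power_minus[of y] mult.commute mult.left_commute)
  have "finite {y. (\<Sum>k\<le>CARD('n). ((- 1) ^ k * e_inv k A) * y ^ k) = 0}"
    by (subst polyfun_finite_roots) (auto intro!: exI[of _ 0] simp: e_inv_0)
  then have "finite (insert 0 ({y. (\<Sum>k\<le>CARD('n). ((- 1) ^ k * e_inv k A) * y ^ k) = 0} \<union> ?Y))"
    using fin by simp
  moreover have "insert 0 ({y. (\<Sum>k\<le>CARD('n). ((- 1) ^ k * e_inv k A) * y ^ k) = 0} \<union> ?Y) = UNIV"
    by (auto simp: det)
  ultimately show False using infinite_UNIV_char_0[where 'a=real] by simp
qed

lemma dE_0: "dE 0 A L = 0"
proof -
  have "((\<lambda>s. e_inv 0 (A + s *\<^sub>R L)) has_real_derivative 0) (at 0)"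
    by (simp add: e_inv_0)
  then show ?thesis using e_inv_line_derivative DERIV_unique by blast
qed

text \<open>The gradients of the \<open>e\<^sub>k\<close> are read off from \<open>det (I - y(A + sL))\<close>: by Jacobi's formula they are the
  coefficients of \<open>adj (I - yA)\<close> as a polynomial in \<open>y\<close>, so multiplying by \<open>I - yA\<close> gives both the
  Faddeev--LeVerrier recursion and the Cayley--Hamilton theorem.\<close>

lemma fl_mat_gradient_and_Cayley_Hamilton:
  fixes A :: "real^'n^'n"
  shows "(\<forall>k<CARD('n). \<forall>L. dE (Suc k) A L = (- 1) ^ k * trace (fl_mat A k ** L)) \<and> fl_mat A CARD('n) = 0"
proof -
  let ?I = "Finite_Cartesian_Product.mat 1 :: real^'n^'n"
  let ?N = "CARD('n)"
  let ?det = "\<lambda>y. Determinants.det (?I - y *\<^sub>R A)"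
  have "\<exists>G. \<forall>L. (- 1) ^ k * dE (Suc k) A L = trace (G ** L)" for k
  proof -
    have "linear (\<lambda>L. (- 1) ^ k * dE (Suc k) A L)"
      using linear_compose_scale_right[OF linear_dE, of "(- 1) ^ k" "Suc k" A] by simp
    then show ?thesis using linear_eq_trace by metis
  qed
  then obtain G where G: "(- 1) ^ k * dE (Suc k) A L = trace (G k ** L)" for k L
    by metis
  \<comment> \<open>\<open>V k\<close> is the coefficient of y^k in (I - y A) times the sum of the
    y^k G_k, minus det (I - y A) I. The conditionals treat k = n and k = 0, where one of the two
    shifted sums has no term.\<close>
  define V where "V k = (if k < ?N then G k else 0) - (if k = 0 then 0 else A ** G (k - 1))
      - ((- 1) ^ k * e_inv k A) *\<^sub>R ?I" for k
  have key: "(\<Sum>k\<le>?N. y ^ k *\<^sub>R V k) = 0" if y: "y \<noteq> 0" "?det y \<noteq> 0" for y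
  proof -
    let ?B = "?I - y *\<^sub>R A"
    have "invertible ?B" using y by (simp add: invertible_det_nz)
    then obtain C where C: "?B ** C = ?I" by (auto simp: invertible_def)
    have "trace ((\<Sum>k<?N. y ^ k *\<^sub>R G k) ** L) = ?det y * trace (C ** L)" for L
    proof -
      \<comment> \<open>Moving A along L moves I - y A along - y L; the factor - y is cancelled
        below.\<close>
      have "((\<lambda>s. Determinants.det (?B + s *\<^sub>R (- y *\<^sub>R L))) has_real_derivative
          ?det y * trace (C ** (- y *\<^sub>R L))) (at 0)"
        by (rule det_line_derivative[OF C])
      moreover have "Determinants.det (?B + s *\<^sub>R (- y *\<^sub>R L)) =
          (\<Sum>k\<le>?N. (- y) ^ k * e_inv k (A + s *\<^sub>R L))" for s
        using det_1_plus_scaleR[of "- y" "A + s *\<^sub>R L"] by (simp add: algebra_simps)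
      moreover have "((\<lambda>s. \<Sum>k\<le>?N. (- y) ^ k * e_inv k (A + s *\<^sub>R L)) has_real_derivative
          (\<Sum>k\<le>?N. (- y) ^ k * dE k A L)) (at 0)"
        by (intro DERIV_sum DERIV_cmult e_inv_line_derivative)
      ultimately have "(\<Sum>k\<le>?N. (- y) ^ k * dE k A L) = ?det y * trace (C ** (- y *\<^sub>R L))"
        using DERIV_unique by simp
      moreover have "(\<Sum>k\<le>?N. (- y) ^ k * dE k A L) = (\<Sum>k<?N. (- y) ^ Suc k * dE (Suc k) A L)"
      proof -
        have "{..?N} = {..<Suc ?N}" by auto
        then show ?thesis by (simp only: sum.lessThan_Suc_shift) (simp add: dE_0)
      qed
      moreover have "\<dots> = - y * (\<Sum>k<?N. y ^ k * trace (G k ** L))"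
        by (simp add: sum_distrib_left G[symmetric] power_minus[of y] algebra_simps)
      ultimately have "- y * (\<Sum>k<?N. y ^ k * trace (G k ** L)) = - y * (?det y * trace (C ** L))"
        by (simp only: matrix_scaleR_right trace_scaleR) simp
      then have "(\<Sum>k<?N. y ^ k * trace (G k ** L)) = ?det y * trace (C ** L)"
        using y by simp
      moreover have "trace ((\<Sum>k<m. y ^ k *\<^sub>R G k) ** L) = (\<Sum>k<m. y ^ k * trace (G k ** L))" for m
        by (induction m) (simp_all add: matrix_add_rdistrib trace_add matrix_scaleR_left trace_scaleR
            trace_0[simplified])
      ultimately show ?thesis by simp
    qed
    then have "trace (((\<Sum>k<?N. y ^ k *\<^sub>R G k) - ?det y *\<^sub>R C) ** L) = 0" for L
      by (simp add: matrix_sub_rdistrib trace_sub matrix_scaleR_left trace_scaleR)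
    then have "(\<Sum>k<?N. y ^ k *\<^sub>R G k) - ?det y *\<^sub>R C = 0"
      by (rule trace_eq_0_iff)
    then have "?B ** (\<Sum>k<?N. y ^ k *\<^sub>R G k) = ?det y *\<^sub>R ?I"
      by (simp add: matrix_scaleR_right C)
    moreover have "?B ** (\<Sum>k<?N. y ^ k *\<^sub>R G k) =
        (\<Sum>k\<le>?N. y ^ k *\<^sub>R (if k < ?N then G k else 0)) - (\<Sum>k\<le>?N. y ^ k *\<^sub>R (if k = 0 then 0 else A ** G (k - 1)))"
    proof -
      have "(\<Sum>k\<le>?N. y ^ k *\<^sub>R (if k < ?N then G k else 0)) = (\<Sum>k<?N. y ^ k *\<^sub>R G k)"
        by (rule sum.mono_neutral_cong_right) auto
      moreover have "(\<Sum>k\<le>?N. y ^ k *\<^sub>R (if k = 0 then 0 else A ** G (k - 1))) =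
          (\<Sum>k<?N. y ^ Suc k *\<^sub>R (A ** G k))"
      proof -
        have "{..?N} = {..<Suc ?N}" by auto
        then show ?thesis by (simp only: sum.lessThan_Suc_shift) simp
      qed
      ultimately show ?thesis
        by (simp add: matrix_sub_rdistrib matrix_sum_right matrix_scaleR_left matrix_scaleR_right
            scaleR_sum_right scaleR_right_diff_distrib sum_subtractf mult.commute)
    qed
    moreover have "?det y *\<^sub>R ?I = (\<Sum>k\<le>?N. y ^ k *\<^sub>R (((- 1) ^ k * e_inv k A) *\<^sub>R ?I))"
    proof -
      have "?det y = (\<Sum>k\<le>?N. y ^ k * ((- 1) ^ k * e_inv k A))"
        using det_1_plus_scaleR[of "- y" A] by (simp add: power_minus[of y] mult.assoc mult.left_commute)
      then show ?thesis by (simp add: scaleR_left.sum)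
    qed
    ultimately show ?thesis
      by (simp add: V_def scaleR_right_diff_distrib sum_subtractf)
  qed
  have V: "V k = 0" if "k \<le> ?N" for k
    by (rule poly_coeffs_eq_0[OF infinite_invertible_1_minus[of A] _ that]) (use key in auto)
  have fl: "k < ?N \<Longrightarrow> fl_mat A k = G k" for k
  proof (induction k)
    case 0
    then show ?case using V[of 0] by (simp add: V_def e_inv_0)
  next
    case (Suc k)
    then show ?case using V[of "Suc k"] by (simp add: V_def algebra_simps)
  qed
  \<comment> \<open>At k = n no G term is present, so V n = 0 says that the next recursion step
    gives 0: Cayley-Hamilton.\<close>
  have "fl_mat A ?N = 0"
  proof -
    obtain m where m: "?N = Suc m" by (cases ?N) auto
    then show ?thesis using V[of ?N] fl[of m] by (simp add: V_def algebra_simps)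
  qed
  moreover have "dE (Suc k) A L = (- 1) ^ k * trace (fl_mat A k ** L)" if "k < ?N" for k L
    unfolding fl[OF that] G[symmetric] by simp
  ultimately show ?thesis by blast
qed

lemmas dE_Suc = fl_mat_gradient_and_Cayley_Hamilton[THEN conjunct1, rule_format]
lemmas fl_mat_CARD = fl_mat_gradient_and_Cayley_Hamilton[THEN conjunct2]

lemma fl_mat_commute: "fl_mat A k ** A = A ** fl_mat A k"
  by (induction k) (simp_all add: matrix_sub_ldistrib matrix_sub_rdistrib matrix_mul_assoc[symmetric]
      matrix_scaleR_left matrix_scaleR_right)

text \<open>Euler's identity evaluates the trace of A F_(k-1), with F = \<open>fl_mat A\<close>, as
  the gradient of e_k in direction A; the recursion then adds n times the signed e_k.\<close>

lemma trace_fl_mat: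
  fixes A :: "real^'n^'n"
  assumes "k < CARD('n)"
  shows "trace (fl_mat A k) = (- 1) ^ k * (real CARD('n) - real k) * e_inv k A"
proof (cases k)
  case 0
  then show ?thesis by (simp add: e_inv_0 trace_I)
next
  case (Suc m)
  have "(- 1) ^ m * trace (fl_mat A m ** A) = of_nat (Suc m) * e_inv (Suc m) A"
    using dE_Suc[of m A A] assms Suc by (simp add: dE_Euler)
  then have "(- 1) ^ m * ((- 1) ^ m * trace (fl_mat A m ** A)) = (- 1) ^ m * (of_nat (Suc m) * e_inv (Suc m) A)"
    by simp
  then have "trace (A ** fl_mat A m) = (- 1) ^ m * (of_nat (Suc m) * e_inv (Suc m) A)"
    by (simp add: fl_mat_commute)
  moreover have "trace (fl_mat A k) = trace (A ** fl_mat A m) + (- 1) ^ k * e_inv k A * real CARD('n)"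
    by (simp only: Suc fl_mat.simps trace_add trace_scaleR trace_I)
  ultimately show ?thesis
    using Suc by (simp add: algebra_simps)
qed

section \<open>The Jordan block of the singular Jacobian\<close>

text \<open>Replaces the choice of a basis adapted to the splitting in all later traces.\<close>

lemma trace_rank_2:
  fixes M :: "real^'n^'n"
  assumes f: "linear f" and g: "linear g" and M: "\<And>v. M *v v = f v *\<^sub>R a + g v *\<^sub>R b"
  shows "trace M = f a + g b"
proof -
  have lin: "(\<Sum>i\<in>UNIV. h (axis i 1) * v $ i) = h v" if "linear h" for h :: "real^'n \<Rightarrow> real" and v
  proof -
    have "h v = h (\<Sum>i\<in>UNIV. v $ i *\<^sub>R axis i 1)"
      by (simp add: basis_expansion flip: scalar_mult_eq_scaleR)
    then show ?thesis
      by (simp add: linear_sum[OF that] linear_cmul[OF that] mult.commute)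
  qed
  have "M $ i $ i = f (axis i 1) * a $ i + g (axis i 1) * b $ i" for i
  proof -
    have "M $ i $ i = (M *v axis i 1) $ i"
      by (simp add: matrix_vector_mult_basis column_def)
    then show ?thesis by (simp add: M)
  qed
  then show ?thesis
    by (simp add: trace_def sum.distrib lin[OF f] lin[OF g])
qed

locale bt_matrix =
  fixes J :: "real^'n^'n" and q0 :: "real^'n"
  assumes CARD_ge_3: "CARD('n) \<ge> 3"
    and rank_J: "rank J = CARD('n) - 1"
    and e_1: "e_inv (CARD('n) - 1) J = 0"
    and e_2: "e_inv (CARD('n) - 2) J \<noteq> 0"
    and span_q0: "span {q0} = mker J"
begin

lemma J_q0: "J *v q0 = 0"
  using span_q0 span_base[of q0 "{q0}"] by (simp add: mker_def)

lemma kernelE: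
  assumes "J *v v = 0"
  obtains c where "v = c *\<^sub>R q0"
proof -
  have "v \<in> span {q0}" using assms span_q0 by (simp add: mker_def)
  then show ?thesis using that by (auto simp: span_singleton)
qed

lemma not_inj_J: "\<not> inj ((*v) J)"
proof
  assume "inj ((*v) J)"
  then have "rank J = CARD('n)" using full_rank_injective by blast
  then show False using rank_J CARD_ge_3 by simp
qed

lemma q0_nonzero: "q0 \<noteq> 0"
proof
  assume "q0 = 0"
  then have "v = 0" if "J *v v = 0" for v
    using kernelE[OF that] by auto
  then have "inj ((*v) J)" by (simp add: linear_injective_0)
  then show False using not_inj_J by blast
qed

lemma e_0: "e_inv CARD('n) J = 0"
  using not_inj_J det_nz_iff_inj_gen[of "(*v) J"] by (simp add: e_inv_CARD)

section \<open>Polynomials in J that realize the splitting\<close>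

definition "c2 = (- 1) ^ (CARD('n) - 2) * e_inv (CARD('n) - 2) J"
definition "c3 = (- 1) ^ (CARD('n) - 3) * e_inv (CARD('n) - 3) J"
text \<open>\<open>c2\<close> and \<open>c3\<close> are the coefficients of x^2 and x^3 in det (x I
  - J), and \<open>D\<close> is the coefficient of x in adj (x I - J).\<close>

definition "D = fl_mat J (CARD('n) - 2)"

lemma c2_nonzero: "c2 \<noteq> 0"
  using e_2 by (simp add: c2_def)

lemma fl_mat_CARD_minus_1: "fl_mat J (CARD('n) - 1) = J ** D"
proof -
  have "CARD('n) - 1 = Suc (CARD('n) - 2)" using CARD_ge_3 by simp
  then show ?thesis using e_1 by (simp add: D_def)
qed

lemma D_commute: "D ** J = J ** D"
  by (simp add: D_def fl_mat_commute)

text \<open>The zeros e_(n-1) and e_n remove the identity terms from the last two recursion steps,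
  and Cayley-Hamilton ends the recursion in 0. As D commutes with J, D vanishes on im J^2.\<close>

lemma JJD: "J ** (J ** D) = 0"
proof -
  have "CARD('n) = Suc (CARD('n) - 1)" using CARD_ge_3 by simp
  then have "fl_mat J CARD('n) = J ** fl_mat J (CARD('n) - 1)"
    using e_0 by (metis add.right_neutral fl_mat.simps(2) mult_zero_right scaleR_zero_left)
  then show ?thesis by (simp only: fl_mat_CARD fl_mat_CARD_minus_1)
qed

lemma D_expansion:
  obtains H where "D = c2 *\<^sub>R Finite_Cartesian_Product.mat 1 + c3 *\<^sub>R J + J ** (J ** H)" "H ** J = J ** H"
proof -
  let ?m = "CARD('n) - 3"
  obtain H where H: "fl_mat J ?m = J ** H + c3 *\<^sub>R Finite_Cartesian_Product.mat 1" "H ** J = J ** H"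
  proof (cases ?m)
    \<comment> \<open>For n = 3 the recursion has not started: \<open>fl_mat J 0\<close> is I, so c3
      = e_0 = 1 and H = 0.\<close>
    case 0
    then show ?thesis using that[of 0] by (simp add: c3_def e_inv_0)
  next
    case (Suc m)
    then show ?thesis using that[of "fl_mat J m"] by (simp add: c3_def fl_mat_commute)
  qed
  have "CARD('n) - 2 = Suc ?m" using CARD_ge_3 by simp
  then have "D = J ** fl_mat J ?m + c2 *\<^sub>R Finite_Cartesian_Product.mat 1"
    by (simp only: D_def c2_def fl_mat.simps)
  then have "D = c2 *\<^sub>R Finite_Cartesian_Product.mat 1 + c3 *\<^sub>R J + J ** (J ** H)"
    by (simp add: H matrix_add_ldistrib matrix_scaleR_right)
  then show ?thesis using that H by blast
qed

lemma D_E_c: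
  assumes "J *v (J *v v) = 0"
  shows "D *v v = c2 *\<^sub>R v + c3 *\<^sub>R (J *v v)"
proof -
  obtain H where H: "D = c2 *\<^sub>R Finite_Cartesian_Product.mat 1 + c3 *\<^sub>R J + J ** (J ** H)" "H ** J = J ** H"
    by (rule D_expansion)
  have "J ** (J ** H) = H ** (J ** J)" by (metis H(2) matrix_mul_assoc)
  then have "(J ** (J ** H)) *v v = H *v (J *v (J *v v))" by (metis matrix_vector_mul_assoc)
  then show ?thesis
    using assms by (simp add: H(1) matrix_vector_mult_add_rdistrib scaleR_matrix_vector_assoc[symmetric])
qed

text \<open>\<open>P\<close> is the projection onto \<open>ker J\<^sup>2\<close> along \<open>im J\<^sup>2\<close>, obtained as a polynomial in \<open>J\<close>.\<close>

lemma projectionE: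
  obtains P K where "J ** (J ** P) = 0" "\<And>v. J *v (J *v v) = 0 \<Longrightarrow> P *v v = v"
    "P + J ** (J ** K) = Finite_Cartesian_Product.mat 1" "K ** J = J ** K" "P ** J = J ** P"
proof -
  let ?I = "Finite_Cartesian_Product.mat 1 :: real^'n^'n"
  obtain H where H: "D = c2 *\<^sub>R ?I + c3 *\<^sub>R J + J ** (J ** H)" "H ** J = J ** H"
    by (rule D_expansion)
  \<comment> \<open>On ker J^2 the inverse of D = c2 I + c3 J is (1 / c2) I - (c3 / c2^2) J, and P
    is D times this. K is read off from I - P, where the terms I and J cancel.\<close>
  define P where "P = (1 / c2) *\<^sub>R D - (c3 / c2\<^sup>2) *\<^sub>R (J ** D)"
  define K where "K = - (1 / c2) *\<^sub>R H + (c3\<^sup>2 / c2\<^sup>2) *\<^sub>R ?I + (c3 / c2\<^sup>2) *\<^sub>R (J ** H)"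
  have 1: "J ** (J ** P) = 0"
    by (simp add: P_def matrix_sub_ldistrib matrix_scaleR_right JJD)
  have 2: "P *v v = v" if v: "J *v (J *v v) = 0" for v
  proof -
    have "J *v (J *v (J *v v)) = 0" using v by simp
    then have "(J ** D) *v v = c2 *\<^sub>R (J *v v)"
      using v D_E_c[of "J *v v"] by (metis D_commute matrix_vector_mul_assoc add.right_neutral scaleR_zero_right)
    then show ?thesis
      using c2_nonzero
      by (simp add: P_def D_E_c[OF v] matrix_vector_mult_diff_rdistrib
          scaleR_matrix_vector_assoc[symmetric] algebra_simps power2_eq_square)
  qed
  have 3: "P + J ** (J ** K) = ?I"
  proof -
    have "J ** D = c2 *\<^sub>R J + c3 *\<^sub>R (J ** J) + J ** (J ** (J ** H))"
      by (simp add: H matrix_add_ldistrib matrix_scaleR_right)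
    moreover have "J ** (J ** K) = - (1 / c2) *\<^sub>R (J ** (J ** H)) + (c3\<^sup>2 / c2\<^sup>2) *\<^sub>R (J ** J)
        + (c3 / c2\<^sup>2) *\<^sub>R (J ** (J ** (J ** H)))"
      by (simp only: K_def matrix_add_ldistrib matrix_scaleR_right matrix_mul_rid)
    ultimately show ?thesis
      using c2_nonzero by (simp add: P_def H(1) algebra_simps power2_eq_square)
  qed
  have 4: "K ** J = J ** K"
    by (simp only: K_def matrix_add_ldistrib matrix_add_rdistrib matrix_scaleR_right matrix_scaleR_left
        matrix_mul_rid matrix_mul_lid matrix_mul_assoc[symmetric] H(2))
  have 5: "P ** J = J ** P"
    by (simp only: P_def matrix_sub_ldistrib matrix_sub_rdistrib matrix_scaleR_right matrix_scaleR_left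
        matrix_mul_assoc[symmetric] D_commute)
  show ?thesis using that[of P K] 1 2 3 4 5 by blast
qed

lemma decompositionE:
  obtains u w where "v = u + J *v (J *v w)" "J *v (J *v u) = 0"
proof -
  obtain P K where P: "J ** (J ** P) = 0" "P + J ** (J ** K) = Finite_Cartesian_Product.mat 1"
    using projectionE by metis
  have "v = (P + J ** (J ** K)) *v v" using P by simp
  also have "\<dots> = P *v v + J *v (J *v (K *v v))"
    by (simp add: matrix_vector_mult_add_rdistrib matrix_vector_mul_assoc)
  finally have "v = P *v v + J *v (J *v (K *v v))" .
  moreover have "J *v (J *v (P *v v)) = 0" by (simp add: matrix_vector_mul_assoc P)
  ultimately show ?thesis using that by blast
qed

lemma D_E_tr: "D *v (J *v (J *v w)) = 0"
proof -
  have "D ** (J ** J) = 0" by (metis D_commute JJD matrix_mul_assoc)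
  then show ?thesis by (simp add: matrix_vector_mul_assoc matrix_mul_assoc)
qed

lemma generalized_kernelE:
  assumes q1: "J *v q1 = q0" and v: "J *v (J *v v) = 0"
  obtains \<alpha> \<beta> where "v = \<alpha> *\<^sub>R q0 + \<beta> *\<^sub>R q1"
proof -
  obtain \<beta> where \<beta>: "J *v v = \<beta> *\<^sub>R q0" using kernelE[OF v] by blast
  then have "J *v (v - \<beta> *\<^sub>R q1) = 0"
    using q1 by (simp add: algebra_simps)
  then obtain \<alpha> where "v - \<beta> *\<^sub>R q1 = \<alpha> *\<^sub>R q0" using kernelE by blast
  then show ?thesis using that[of \<alpha> \<beta>] by (simp add: algebra_simps)
qed

text \<open>If \<open>q0\<close> were not in the image of \<open>J\<close>, then \<open>ker J\<^sup>2\<close> would be a line and \<open>D\<close>, which vanishes on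
  \<open>im J\<^sup>2\<close>, would have trace \<open>c2\<close> instead of \<open>2 c2\<close>.\<close>

lemma q1_exists: "\<exists>q1. J *v q1 = q0"
proof (rule ccontr)
  assume no: "\<not> ?thesis"
  obtain P K where P: "J ** (J ** P) = 0" "\<And>v. J *v (J *v v) = 0 \<Longrightarrow> P *v v = v"
    "P + J ** (J ** K) = Finite_Cartesian_Product.mat 1"
    using projectionE by metis
  define f where "f v = ((P *v v) \<bullet> q0) / (q0 \<bullet> q0)" for v
  have lin: "linear f"
    by (rule linearI) (simp_all add: f_def algebra_simps inner_add_left add_divide_distrib)
  have f: "P *v v = f v *\<^sub>R q0" for v
  proof -
    have "J *v (J *v (P *v v)) = 0" by (simp add: matrix_vector_mul_assoc P)
    then obtain \<beta> where \<beta>: "J *v (P *v v) = \<beta> *\<^sub>R q0" using kernelE by blast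
    have "\<beta> = 0"
    proof (rule ccontr)
      assume "\<beta> \<noteq> 0"
      then have "J *v ((1 / \<beta>) *\<^sub>R (P *v v)) = q0" by (simp add: \<beta> matrix_vector_mult_scaleR)
      then show False using no by blast
    qed
    then obtain c where "P *v v = c *\<^sub>R q0" using \<beta> kernelE by fastforce
    then show ?thesis using q0_nonzero by (simp add: f_def)
  qed
  have Pq0: "P *v q0 = q0" by (rule P(2)) (simp add: J_q0)
  then have "f q0 = 1" using q0_nonzero by (simp add: f_def)
  have "D *v v = f v *\<^sub>R (c2 *\<^sub>R q0) + 0 *\<^sub>R 0" for v
  proof -
    have "D *v v = D *v ((P + J ** (J ** K)) *v v)" by (simp add: P)
    also have "\<dots> = D *v (P *v v) + D *v (J *v (J *v (K *v v)))"
      by (simp add: matrix_vector_mult_add_rdistrib matrix_vector_mul_assoc matrix_vector_right_distrib)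
    also have "\<dots> = f v *\<^sub>R (c2 *\<^sub>R q0)"
      by (simp add: f D_E_tr D_E_c J_q0 matrix_vector_mult_scaleR)
    finally show ?thesis by simp
  qed
  from trace_rank_2[OF lin _ this] have "trace D = f (c2 *\<^sub>R q0)"
    by (simp add: linear_zero)
  also have "\<dots> = c2" using \<open>f q0 = 1\<close> by (simp add: linear_cmul[OF lin])
  finally have "trace D = c2" .
  moreover have "trace D = 2 * c2"
    using CARD_ge_3 by (simp add: D_def trace_fl_mat c2_def of_nat_diff)
  ultimately show False using c2_nonzero by simp
qed

section \<open>Frames of ker J^2, and traces of matrices that vanish on im J^2\<close>

lemma independent_q0_q1:
  assumes q1: "J *v q1 = q0"
  shows "independent {q0, q1}" "q0 \<noteq> q1"
proof -
  show ne: "q0 \<noteq> q1" using q1 J_q0 q0_nonzero by auto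
  have "q1 \<notin> span {q0}"
    using q1 q0_nonzero by (auto simp: span_q0 mker_def)
  then have "independent (insert q1 {q0})"
    using q0_nonzero by (subst independent_insert) auto
  then show "independent {q0, q1}" by (simp add: insert_commute)
qed

text \<open>Functionals dual to q0 and q1 are extended to R^n and composed with the projection P,
  which makes them vanish on im J^2.\<close>

lemma frame_exists: "\<exists>q1 p0 p1. BT_frame J q0 q1 p0 p1"
proof -
  obtain q1 where q1: "J *v q1 = q0" using q1_exists by blast
  obtain P K where P: "J ** (J ** P) = 0" "\<And>v. J *v (J *v v) = 0 \<Longrightarrow> P *v v = v" "P ** J = J ** P"
    using projectionE by metis
  have *: "\<exists>f. linear f \<and> f q0 = x \<and> f q1 = (y :: real)" for x y
  proof -
    obtain f where "linear f" "\<forall>v\<in>{q0, q1}. f v = (if v = q0 then x else y)"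
      using linear_independent_extend[OF independent_q0_q1(1)[OF q1], of "\<lambda>v. if v = q0 then x else y"]
      by blast
    then show ?thesis using independent_q0_q1(2)[OF q1] by auto
  qed
  obtain f0 where f0: "linear f0" "f0 q0 = 1" "f0 q1 = (0 :: real)" using * by metis
  obtain f1 where f1: "linear f1" "f1 q0 = 0" "f1 q1 = (1 :: real)" using * by metis
  have lin: "linear (\<lambda>v. f (P *v v))" if "linear f" for f :: "real^'n \<Rightarrow> real"
    using linear_compose[OF matrix_vector_mul_linear that] by (simp add: o_def)
  have PE: "P *v v = 0" if "v \<in> E_tr J" for v
  proof -
    from that obtain w where w: "v = (J ** J) *v w" by (auto simp: E_tr_def)
    have "P ** (J ** J) = 0" by (metis P(1,3) matrix_mul_assoc)
    then show ?thesis by (simp add: w matrix_vector_mul_assoc)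
  qed
  have Pq: "P *v q0 = q0" "P *v q1 = q1"
    by (rule P(2); simp add: q1 J_q0)+
  have "q1 \<in> E_c J"
    using q1 J_q0 by (simp add: E_c_def mker_def matrix_vector_mul_assoc[symmetric])
  then have "BT_frame J q0 q1 (\<lambda>v. f0 (P *v v)) (\<lambda>v. f1 (P *v v))"
    using q1 f0 f1 by (simp add: BT_frame_def lin Pq PE linear_0)
  then show ?thesis by blast
qed

lemma frame_decompositionE:
  assumes fr: "BT_frame J q0 q1 p0 p1"
  obtains w where "v = p0 v *\<^sub>R q0 + p1 v *\<^sub>R q1 + J *v (J *v w)"
proof -
  obtain u w where v: "v = u + J *v (J *v w)" and u: "J *v (J *v u) = 0"
    by (rule decompositionE)
  have q1: "J *v q1 = q0" and lin: "linear p0" "linear p1" using fr by (auto simp: BT_frame_def)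
  obtain \<alpha> \<beta> where ab: "u = \<alpha> *\<^sub>R q0 + \<beta> *\<^sub>R q1" by (rule generalized_kernelE[OF q1 u])
  have "J *v (J *v w) \<in> E_tr J" by (auto simp: E_tr_def matrix_vector_mul_assoc)
  then have "p0 v = \<alpha>" "p1 v = \<beta>"
    using fr by (simp_all add: v ab linear_add[OF lin(1)] linear_add[OF lin(2)]
        linear_cmul[OF lin(1)] linear_cmul[OF lin(2)] BT_frame_def)
  then show ?thesis using that v ab by blast
qed

text \<open>By the frame decomposition M v depends on v only through p0 v and p1 v, so M has rank at
  most two.\<close>

lemma trace_vanishing_E_tr:
  assumes fr: "BT_frame J q0 q1 p0 p1" and 0: "\<And>w. M *v (J *v (J *v w)) = 0"
  shows "trace M = p0 (M *v q0) + p1 (M *v q1)"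
proof (rule trace_rank_2)
  fix v
  obtain w where w: "v = p0 v *\<^sub>R q0 + p1 v *\<^sub>R q1 + J *v (J *v w)"
    by (rule frame_decompositionE[OF fr])
  have "M *v v = M *v (p0 v *\<^sub>R q0 + p1 v *\<^sub>R q1 + J *v (J *v w))" using w by simp
  then show "M *v v = p0 v *\<^sub>R (M *v q0) + p1 v *\<^sub>R (M *v q1)"
    by (simp add: matrix_vector_right_distrib matrix_vector_mult_scaleR 0)
qed (use fr in \<open>auto simp: BT_frame_def\<close>)

text \<open>The scalar part of D on ker J^2 gives the diagonal entries of L there, the nilpotent
  part the entry p1 (L q0). For L = D^2 X(q0, .) the result is c2 b + 2 c3 a.\<close>

lemma trace_D_mult:
  assumes fr: "BT_frame J q0 q1 p0 p1"
  shows "trace (D ** L) = c2 * (p0 (L *v q0) + p1 (L *v q1)) + c3 * p1 (L *v q0)"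
proof -
  have lin: "linear p0" "linear p1" and q1: "J *v q1 = q0" using fr by (auto simp: BT_frame_def)
  have "D *v q0 = c2 *\<^sub>R q0" "D *v q1 = c2 *\<^sub>R q1 + c3 *\<^sub>R q0"
    by (simp_all add: D_E_c J_q0 q1)
  \<comment> \<open>The product is reversed because the factor that vanishes on im J^2 has to act
    first.\<close>
  moreover have "trace (L ** D) = p0 ((L ** D) *v q0) + p1 ((L ** D) *v q1)"
    by (rule trace_vanishing_E_tr[OF fr]) (simp add: matrix_vector_mul_assoc[symmetric] D_E_tr)
  ultimately show ?thesis
    by (simp add: trace_mul_sym[of D L] matrix_vector_mul_assoc[symmetric] matrix_vector_right_distrib
        matrix_vector_mult_scaleR linear_add[OF lin(1)] linear_add[OF lin(2)]
        linear_cmul[OF lin(1)] linear_cmul[OF lin(2)] algebra_simps)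
qed

text \<open>J D sends q1 to c2 q0 and q0 to 0, so only the entry that defines a is left.\<close>

lemma trace_JD_mult:
  assumes fr: "BT_frame J q0 q1 p0 p1"
  shows "trace ((J ** D) ** L) = c2 * p1 (L *v q0)"
proof -
  have lin: "linear p0" "linear p1" and q1: "J *v q1 = q0" using fr by (auto simp: BT_frame_def)
  have "J *v (D *v q0) = 0" "J *v (D *v q1) = c2 *\<^sub>R q0"
    by (simp_all add: D_E_c J_q0 q1 matrix_vector_right_distrib matrix_vector_mult_scaleR)
  moreover have "trace (L ** (J ** D)) = p0 ((L ** (J ** D)) *v q0) + p1 ((L ** (J ** D)) *v q1)"
    by (rule trace_vanishing_E_tr[OF fr]) (simp add: matrix_vector_mul_assoc[symmetric] D_E_tr)
  ultimately show ?thesis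
    by (simp add: trace_mul_sym[of "J ** D" L] matrix_vector_mul_assoc[symmetric]
        matrix_vector_mult_scaleR linear_0[OF lin(1)] linear_cmul[OF lin(2)])
qed

section \<open>Nonvanishing of the lower gradients on im J^2\<close>

lemma E_tr_range_JJJJ:
  obtains x where "J *v (J *v w) = J *v (J *v (J *v (J *v x)))"
proof -
  obtain u x where w: "w = u + J *v (J *v x)" "J *v (J *v u) = 0"
    by (rule decompositionE)
  then show ?thesis using that[of x] by (simp add: matrix_vector_right_distrib)
qed

text \<open>If \<open>fl_mat J m\<close> vanished on \<open>im J\<^sup>2\<close>, its trace would be the one on \<open>ker J\<^sup>2\<close>, namely
  \<open>\<plusminus>2 e\<^sub>m\<close>, instead of \<open>\<plusminus>(n - m) e\<^sub>m\<close>; so \<open>e\<^sub>m = 0\<close>, and the recursion passes the vanishing on to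
  \<open>m - 1\<close>, down to \<open>fl_mat J 0 = I\<close>.\<close>

lemma fl_mat_nonzero_E_tr:
  assumes "m + 3 \<le> CARD('n)"
  shows "\<exists>w. fl_mat J m *v (J *v (J *v w)) \<noteq> 0"
  using assms
proof (induction m)
  case 0
  show ?case
  proof (rule ccontr)
    assume "\<nexists>w. fl_mat J 0 *v (J *v (J *v w)) \<noteq> 0"
    \<comment> \<open>If I vanishes on im J^2, then J^2 = 0, and the trace of I would be 2 instead
      of n.\<close>
    then have JJ: "J *v (J *v w) = 0" for w by simp
    obtain q1 p0 p1 where fr: "BT_frame J q0 q1 p0 p1" using frame_exists by blast
    have "trace (Finite_Cartesian_Product.mat 1 :: real^'n^'n) = 2"
      using trace_vanishing_E_tr[OF fr, of "Finite_Cartesian_Product.mat 1"] fr JJ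
      by (simp add: BT_frame_def)
    then show False using CARD_ge_3 by (simp add: trace_I)
  qed
next
  case (Suc m)
  show ?case
  proof (rule ccontr)
    let ?M = "fl_mat J (Suc m)"
    let ?e = "(- 1) ^ Suc m * e_inv (Suc m) J"
    assume "\<nexists>w. ?M *v (J *v (J *v w)) \<noteq> 0"
    then have 0: "?M *v (J *v (J *v w)) = 0" for w by blast
    obtain q1 p0 p1 where fr: "BT_frame J q0 q1 p0 p1" using frame_exists by blast
    then have lin: "linear p0" "linear p1" and q1: "J *v q1 = q0" by (auto simp: BT_frame_def)
    have M: "?M *v v = fl_mat J m *v (J *v v) + ?e *\<^sub>R v" for v
      by (simp only: fl_mat.simps matrix_vector_mult_add_rdistrib scaleR_matrix_vector_assoc[symmetric]
          matrix_vector_mul_lid matrix_vector_mul_assoc fl_mat_commute)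
    have "J *v (fl_mat J m *v q0) = 0"
      by (metis fl_mat_commute matrix_vector_mul_assoc J_q0 matrix_vector_mult_0_right)
    \<comment> \<open>The term c q0 will drop out of the trace because p1 q0 = 0.\<close>
    then obtain c where c: "fl_mat J m *v q0 = c *\<^sub>R q0" by (rule kernelE)
    have "?M *v q0 = ?e *\<^sub>R q0" "?M *v q1 = c *\<^sub>R q0 + ?e *\<^sub>R q1"
      by (simp_all only: M J_q0 q1 c matrix_vector_mult_0_right add_0)
    then have "trace ?M = 2 * ?e"
      using trace_vanishing_E_tr[OF fr, of ?M, OF 0] fr
      by (simp add: BT_frame_def linear_add[OF lin(2)] linear_cmul[OF lin(1)] linear_cmul[OF lin(2)]
          linear_0[OF lin(1)] linear_diff[OF lin(2)] linear_neg[OF lin(1)] linear_neg[OF lin(2)] del: fl_mat.simps)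
    moreover have "trace ?M = (real CARD('n) - real (Suc m)) * ?e"
      using Suc.prems by (subst trace_fl_mat) simp_all
    ultimately have "(real CARD('n) - real (Suc m) - 2) * ?e = 0"
      by (simp add: algebra_simps)
    moreover have "real CARD('n) - real (Suc m) - 2 > 0" using Suc.prems by linarith
    ultimately have e: "?e = 0" by (metis less_irrefl mult_eq_0_iff)
    \<comment> \<open>J maps im J^2 onto itself, so every vector there is J u with u again in im
      J^2.\<close>
    have "fl_mat J m *v (J *v (J *v w)) = 0" for w
    proof -
      obtain x where x: "J *v (J *v w) = J *v (J *v (J *v (J *v x)))" by (rule E_tr_range_JJJJ)
      have "?M *v (J *v (J *v (J *v x))) = fl_mat J m *v (J *v (J *v (J *v (J *v x))))"
        by (simp only: M e scaleR_zero_left add_0_right)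
      then show ?thesis using 0[of "J *v x"] x by simp
    qed
    then show False using Suc by simp
  qed
qed

text \<open>The matrices J^2 N J^2 kill ker J^2 and map into im J^2; they become the perturbations
  of L. If all these traces vanished, cyclicity would give J^2 F J^2 = F J^4 = 0 for F =
  \<open>fl_mat J m\<close>, while im J^4 = im J^2.\<close>

lemma trace_fl_mat_E_tr_nonzero:
  assumes "m + 3 \<le> CARD('n)"
  shows "\<exists>N. trace (fl_mat J m ** (J ** J ** N ** J ** J)) \<noteq> 0"
proof (rule ccontr)
  let ?F = "fl_mat J m"
  assume "\<not> ?thesis"
  then have "trace ((J ** J ** ?F ** J ** J) ** N) = 0" for N
    using trace_mul_sym[of "?F ** J ** J ** N" "J ** J"] by (simp add: matrix_mul_assoc)
  then have "J ** J ** ?F ** J ** J = 0" by (rule trace_eq_0_iff)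
  then have *: "?F ** J ** J ** J ** J = 0"
    by (metis fl_mat_commute matrix_mul_assoc)
  obtain w where w: "?F *v (J *v (J *v w)) \<noteq> 0" using fl_mat_nonzero_E_tr[OF assms] by blast
  obtain x where x: "J *v (J *v w) = J *v (J *v (J *v (J *v x)))" by (rule E_tr_range_JJJJ)
  have "?F *v (J *v (J *v w)) = (?F ** J ** J ** J ** J) *v x"
    unfolding x by (simp add: matrix_vector_mul_assoc matrix_mul_assoc)
  then show False using w * by simp
qed

section \<open>Dimension of im J^2 and invertibility of J on it\<close>

lemma dim_E_tr: "dim (E_tr J) = CARD('n) - 2"
proof -
  obtain q1 where q1: "J *v q1 = q0" using q1_exists by blast
  have Ec: "E_c J = span {q0, q1}"
  proof
    show "E_c J \<subseteq> span {q0, q1}"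
    proof
      fix v assume "v \<in> E_c J"
      then have "J *v (J *v v) = 0" by (simp add: E_c_def mker_def matrix_vector_mul_assoc)
      then obtain \<alpha> \<beta> where "v = \<alpha> *\<^sub>R q0 + \<beta> *\<^sub>R q1" by (rule generalized_kernelE[OF q1])
      then show "v \<in> span {q0, q1}" by (simp add: span_add span_base span_scale)
    qed
    have "subspace (E_c J)"
      by (simp add: subspace_def E_c_def mker_def matrix_vector_right_distrib matrix_vector_mult_scaleR)
    then show "span {q0, q1} \<subseteq> E_c J"
      using q1 J_q0 by (intro span_minimal) (auto simp: E_c_def mker_def matrix_vector_mul_assoc[symmetric])
  qed
  have sub: "subspace (E_c J)" "subspace (E_tr J)"
    unfolding Ec E_tr_def by (auto intro: linear_subspace_image matrix_vector_mul_linear)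
  have "v \<in> {x + y |x y. x \<in> E_c J \<and> y \<in> E_tr J}" for v
  proof -
    obtain u w where "v = u + J *v (J *v w)" "J *v (J *v u) = 0" by (rule decompositionE)
    then show ?thesis
      by (auto simp: E_c_def E_tr_def mker_def matrix_vector_mul_assoc)
  qed
  then have "{x + y |x y. x \<in> E_c J \<and> y \<in> E_tr J} = UNIV" by blast
  moreover have "E_c J \<inter> E_tr J = {0}"
  proof
    show "E_c J \<inter> E_tr J \<subseteq> {0}"
    proof
      fix v assume v: "v \<in> E_c J \<inter> E_tr J"
      obtain P K where P: "J ** (J ** P) = 0" "\<And>v. J *v (J *v v) = 0 \<Longrightarrow> P *v v = v" "P ** J = J ** P"
        using projectionE by metis
      have "P *v v = v" using v by (intro P(2)) (simp add: E_c_def mker_def matrix_vector_mul_assoc)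
      moreover obtain w where "v = (J ** J) *v w" using v by (auto simp: E_tr_def)
      moreover have "P ** (J ** J) = 0" by (metis P(1,3) matrix_mul_assoc)
      ultimately show "v \<in> {0}" by (metis matrix_vector_mul_assoc matrix_vector_mult_0 singletonI)
    qed
  qed (use sub subspace_0 in auto)
  moreover have "dim (E_c J) = 2"
    using independent_q0_q1[OF q1] by (simp add: Ec dim_eq_card_independent)
  ultimately show ?thesis
    using dim_sums_Int[OF sub] by simp
qed

text \<open>The projection P is 0 on im J^2, so J^2 K is the identity there and G = J K inverts
  J.\<close>

lemma J_inverse_on_E_trE:
  obtains G where "\<And>v. v \<in> E_tr J \<Longrightarrow> G *v v \<in> E_tr J"
    "\<And>v. v \<in> E_tr J \<Longrightarrow> J *v (G *v v) = v" "\<And>v. v \<in> E_tr J \<Longrightarrow> G *v (J *v v) = v"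
proof -
  obtain P K where P: "J ** (J ** P) = 0" "P + J ** (J ** K) = Finite_Cartesian_Product.mat 1"
    "K ** J = J ** K" "P ** J = J ** P"
    using projectionE by metis
  have *: "J *v (J *v (K *v v)) = v" if "v \<in> E_tr J" for v
  proof -
    obtain w where w: "v = (J ** J) *v w" using \<open>v \<in> E_tr J\<close> unfolding E_tr_def by blast
    have "P ** (J ** J) = 0" by (metis P(1,4) matrix_mul_assoc)
    then have "P *v v = 0" by (simp add: w matrix_vector_mul_assoc)
    moreover have "v = (P + J ** (J ** K)) *v v" by (simp add: P)
    ultimately show ?thesis
      by (simp add: matrix_vector_mult_add_rdistrib matrix_vector_mul_assoc)
  qed
  have K: "K *v (J *v v) = J *v (K *v v)" for v
    by (simp add: P(3) matrix_vector_mul_assoc)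
  show ?thesis
  proof (rule that[of "J ** K"])
    fix v assume v: "v \<in> E_tr J"
    then obtain w where "v = J *v (J *v w)" by (auto simp: E_tr_def matrix_vector_mul_assoc)
    then have "(J ** K) *v v = (J ** J) *v (J *v (K *v w))"
      by (simp add: K flip: matrix_vector_mul_assoc)
    then show "(J ** K) *v v \<in> E_tr J" by (auto simp: E_tr_def)
  qed (simp_all add: * K flip: matrix_vector_mul_assoc)
qed

end

section \<open>Second-order perturbations of the vector field\<close>

text \<open>\<open>C2_on\<close> speaks of operator-valued derivatives, \<open>DX\<close> of
  matrices; this map carries differentiability from one to the other.\<close>

lemma bounded_linear_matrix_blinfun:
  "bounded_linear (\<lambda>f :: (real^'n) \<Rightarrow>\<^sub>L (real^'m). matrix (blinfun_apply f))"
proof -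
  have "bounded_linear (\<lambda>f :: (real^'n) \<Rightarrow>\<^sub>L (real^'m). matrix (blinfun_apply f) \<bullet> b)"
    if "b \<in> Basis" for b :: "real^'n^'m"
  proof -
    from that obtain i j where "b = axis i (axis j 1)"
      by (auto simp: Basis_vec_def)
    then have "(\<lambda>f. matrix (blinfun_apply f) \<bullet> b) = (\<lambda>f. blinfun_apply f (axis j 1) $ i)"
      by (auto simp: inner_axis matrix_def)
    moreover have "bounded_linear (\<lambda>f :: (real^'n) \<Rightarrow>\<^sub>L (real^'m). blinfun_apply f (axis j 1) $ i)"
      by (intro bounded_linear_compose[OF bounded_linear_vec_nth] blinfun.bounded_linear_left)
    ultimately show ?thesis by simp
  qed
  then show ?thesis by (subst bounded_linear_componentwise_iff) blast
qed

lemma DX_eq_matrix: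
  assumes "(X has_derivative f) (at x)"
  shows "DX X x = matrix f"
  using frechet_derivative_at[OF assms] by (simp add: jacobian_def)

lemma has_derivative_DX:
  fixes X :: "real^'n \<Rightarrow> real^'n"
  assumes U: "open U" "p \<in> U" and C2: "C2_on U X"
  shows "((\<lambda>x. DX X x) has_derivative frechet_derivative (\<lambda>x. DX X x) (at p)) (at p)"
proof -
  obtain X' :: "real^'n \<Rightarrow> (real^'n) \<Rightarrow>\<^sub>L (real^'n)" and X''
    where X': "\<And>x. x \<in> U \<Longrightarrow> (X has_derivative blinfun_apply (X' x)) (at x)"
      and X'': "\<And>x. x \<in> U \<Longrightarrow> (X' has_derivative blinfun_apply (X'' x)) (at x)"
    using C2 unfolding C2_on_def by blast
  have "((\<lambda>x. matrix (blinfun_apply (X' x))) has_derivative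
      (\<lambda>h. matrix (blinfun_apply (blinfun_apply (X'' p) h)))) (at p)"
    by (rule bounded_linear.has_derivative[OF bounded_linear_matrix_blinfun X''[OF U(2)]])
  then have "((\<lambda>x. DX X x) has_derivative
      (\<lambda>h. matrix (blinfun_apply (blinfun_apply (X'' p) h)))) (at p)"
    by (rule has_derivative_transform_within_open[OF _ U]) (simp add: DX_eq_matrix[OF X'])
  then show ?thesis using frechet_derivative_works differentiableI by blast
qed

text \<open>By the chain rule X enters only through DX(p) and the matrix D^2 X(q, .), so that
  everything reduces to traces.\<close>

lemma De_eq_dE:
  fixes X :: "real^'n \<Rightarrow> real^'n"
  assumes "open U" "p \<in> U" "C2_on U X"
  shows "De k X p q = dE k (DX X p) (frechet_derivative (\<lambda>x. DX X x) (at p) q)"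
proof -
  let ?L = "frechet_derivative (\<lambda>x. DX X x) (at p)"
  have D: "((\<lambda>x. DX X x) has_derivative ?L) (at (p + 0 *\<^sub>R q))"
    using has_derivative_DX[OF assms] by simp
  have "((\<lambda>s. DX X (p + s *\<^sub>R q)) has_derivative (\<lambda>s. ?L (s *\<^sub>R q))) (at 0)"
    by (rule has_derivative_compose[where f = "\<lambda>s. p + s *\<^sub>R q" and g = "\<lambda>x. DX X x", OF _ D]) (auto intro!: derivative_eq_intros)
  then have "((\<lambda>s. DX X (p + s *\<^sub>R q)) has_vector_derivative ?L q) (at 0)"
    using linear_cmul[OF has_derivative_linear[OF D]] by (simp add: has_vector_derivative_def)
  from has_field_derivative_e_inv_curve[OF this, of k] show ?thesis
    by (simp add: De_def DERIV_imp_deriv)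
qed

lemma matrix_plus: "matrix (\<lambda>v. f v + g v) = matrix f + matrix g"
  by (simp add: matrix_def Finite_Cartesian_Product.vec_eq_iff)

lemma quadratic_perturbation:
  fixes X :: "real^'n \<Rightarrow> real^'n" and \<beta> :: "real^'n \<Rightarrow> real^'n \<Rightarrow> real^'n"
  assumes U: "open U" "p \<in> U" and C2: "C2_on U X"
    and bil: "bilinear \<beta>" and sym: "\<And>u v. \<beta> u v = \<beta> v u"
  defines "Y \<equiv> \<lambda>x. X x + (1/2) *\<^sub>R \<beta> (x - p) (x - p)"
  shows "C2_on U Y" "Y p = X p" "DX Y p = DX X p"
    "frechet_derivative (\<lambda>x. DX Y x) (at p) u = frechet_derivative (\<lambda>x. DX X x) (at p) u + matrix (\<beta> u)"
    "D2X Y p u v = D2X X p u v + \<beta> u v"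
proof -
  have bb: "bounded_bilinear \<beta>" using bil by (simp add: bilinear_conv_bounded_bilinear)
  interpret \<beta>: bounded_bilinear \<beta> by (rule bb)
  have app1: "blinfun_apply (Blinfun (\<beta> u)) = \<beta> u" for u
    by (rule bounded_linear_Blinfun_apply) (rule \<beta>.bounded_linear_right)
  have "linear (\<lambda>u. Blinfun (\<beta> u))"
    by (rule linearI; rule blinfun_eqI) (simp_all add: app1 blinfun.bilinear_simps \<beta>.add_left \<beta>.scaleR_left)
  then have bl: "bounded_linear (\<lambda>u. Blinfun (\<beta> u))" by (simp add: linear_conv_bounded_linear)
  \<comment> \<open>Z is \<beta> as an operator with operator values, the constant second derivative
    of the added term.\<close>
  define Z where "Z = Blinfun (\<lambda>u. Blinfun (\<beta> u))"
  have Z: "blinfun_apply (blinfun_apply Z u) = \<beta> u" for u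
    by (simp add: Z_def bounded_linear_Blinfun_apply[OF bl] app1)
  obtain X' :: "real^'n \<Rightarrow> (real^'n) \<Rightarrow>\<^sub>L (real^'n)" and X''
    where X': "\<And>x. x \<in> U \<Longrightarrow> (X has_derivative blinfun_apply (X' x)) (at x)"
      and X'': "\<And>x. x \<in> U \<Longrightarrow> (X' has_derivative blinfun_apply (X'' x)) (at x)"
      and cont: "continuous_on U X''"
    using C2 unfolding C2_on_def by blast
  have Y': "(Y has_derivative (\<lambda>h. blinfun_apply (X' x) h + \<beta> (x - p) h)) (at x)" if "x \<in> U" for x
  proof -
    have "((\<lambda>x. \<beta> (x - p) (x - p)) has_derivative (\<lambda>h. \<beta> (x - p) h + \<beta> h (x - p))) (at x)"
      by (rule \<beta>.FDERIV) (auto intro!: derivative_eq_intros)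
    then have "((\<lambda>x. (1/2) *\<^sub>R \<beta> (x - p) (x - p)) has_derivative
        (\<lambda>h. (1/2) *\<^sub>R (\<beta> (x - p) h + \<beta> h (x - p)))) (at x)"
      by (rule has_derivative_scaleR_right)
    \<comment> \<open>Symmetry merges the two product-rule terms and cancels 1/2, so the second
      derivative grows by exactly \<beta>.\<close>
    moreover have "(1/2) *\<^sub>R (\<beta> (x - p) h + \<beta> h (x - p)) = \<beta> (x - p) h" for h
      by (simp add: sym[of h] flip: scaleR_2)
    ultimately have "((\<lambda>x. (1/2) *\<^sub>R \<beta> (x - p) (x - p)) has_derivative (\<lambda>h. \<beta> (x - p) h)) (at x)"
      by simp
    from has_derivative_add[OF X'[OF that] this] show ?thesis unfolding Y_def .
  qed
  show "C2_on U Y"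
    unfolding C2_on_def
  proof (intro exI conjI ballI)
    fix x assume x: "x \<in> U"
    show "(Y has_derivative blinfun_apply (X' x + blinfun_apply Z (x - p))) (at x)"
      using Y'[OF x] by (simp add: plus_blinfun.rep_eq Z)
    have "((\<lambda>x. blinfun_apply Z (x - p)) has_derivative blinfun_apply Z) (at x)"
      using bounded_linear.has_derivative[OF blinfun.bounded_linear_right, of "\<lambda>x. x - p" "\<lambda>h. h" "at x" Z]
      by (auto intro!: derivative_eq_intros)
    from has_derivative_add[OF X''[OF x] this]
    show "((\<lambda>x. X' x + blinfun_apply Z (x - p)) has_derivative blinfun_apply (X'' x + Z)) (at x)"
      by (simp add: plus_blinfun.rep_eq)
  qed (intro continuous_intros cont)
  show "Y p = X p" by (simp add: Y_def \<beta>.zero_left)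
  have DXY: "DX Y x = DX X x + matrix (\<beta> (x - p))" if "x \<in> U" for x
    by (simp add: DX_eq_matrix[OF Y'[OF that]] DX_eq_matrix[OF X'[OF that]] matrix_plus)
  have "matrix (\<beta> 0) = 0"
    by (simp add: matrix_def Finite_Cartesian_Product.vec_eq_iff \<beta>.zero_left)
  then show "DX Y p = DX X p" by (simp add: DXY[OF U(2)])
  have "linear (\<lambda>u. matrix (\<beta> u))"
    by (rule linearI)
      (simp_all add: matrix_def Finite_Cartesian_Product.vec_eq_iff \<beta>.add_left \<beta>.scaleR_left)
  then have "bounded_linear (\<lambda>u. matrix (\<beta> u))" by (simp add: linear_conv_bounded_linear)
  then have "((\<lambda>x. matrix (\<beta> (x - p))) has_derivative (\<lambda>u. matrix (\<beta> u))) (at p)"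
    by (rule bounded_linear.has_derivative) (auto intro!: derivative_eq_intros)
  from has_derivative_add[OF has_derivative_DX[OF U C2] this]
  have "((\<lambda>x. DX Y x) has_derivative
      (\<lambda>u. frechet_derivative (\<lambda>x. DX X x) (at p) u + matrix (\<beta> u))) (at p)"
    by (rule has_derivative_transform_within_open[OF _ U]) (simp add: DXY)
  from fun_cong[OF frechet_derivative_at[OF this], symmetric]
  show fr: "frechet_derivative (\<lambda>x. DX Y x) (at p) u =
      frechet_derivative (\<lambda>x. DX X x) (at p) u + matrix (\<beta> u)" for u .
  have "matrix (\<beta> u) *v v = \<beta> u v"
    by (rule fun_cong[OF matrix_vector_mul(3)[OF \<beta>.bounded_linear_right]])
  then show "D2X Y p u v = D2X X p u v + \<beta> u v"
    by (simp add: D2X_def fr matrix_vector_mult_add_rdistrib)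
qed

section \<open>Derivatives expressed by (a, b), and fields that change the remaining ones\<close>

context bt_matrix begin

text \<open>Up to sign the gradients of e_n and e_(n-1) at J are J D and D. Both vanish on im J^2,
  which is why the second derivative enters only through a and b.\<close>

lemma De_CARD:
  assumes "open U" "p \<in> U" "C2_on U X" "DX X p = J" and fr: "BT_frame J q0 q1 p0 p1"
  shows "De CARD('n) X p q0 = (- 1) ^ (CARD('n) - 1) * c2 * p1 (D2X X p q0 q0)"
proof -
  let ?L = "frechet_derivative (\<lambda>x. DX X x) (at p) q0"
  have N: "CARD('n) = Suc (CARD('n) - 1)" using CARD_ge_3 by simp
  have "De CARD('n) X p q0 = dE CARD('n) J ?L"
    using De_eq_dE[OF assms(1-3)] assms(4) by simp
  also have "\<dots> = dE (Suc (CARD('n) - 1)) J ?L"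
    by (rule arg_cong[OF N, of "\<lambda>k. dE k J ?L"])
  also have "\<dots> = (- 1) ^ (CARD('n) - 1) * trace (fl_mat J (CARD('n) - 1) ** ?L)"
    by (rule dE_Suc) simp
  finally show ?thesis
    by (simp only: fl_mat_CARD_minus_1 trace_JD_mult[OF fr] D2X_def mult.assoc)
qed

lemma De_CARD_minus_1:
  assumes "open U" "p \<in> U" "C2_on U X" "DX X p = J" and fr: "BT_frame J q0 q1 p0 p1"
  shows "De (CARD('n) - 1) X p q0 = (- 1) ^ (CARD('n) - 2) *
    (c2 * (p0 (D2X X p q0 q0) + p1 (D2X X p q0 q1)) + c3 * p1 (D2X X p q0 q0))"
proof -
  let ?L = "frechet_derivative (\<lambda>x. DX X x) (at p) q0"
  have N: "CARD('n) - 1 = Suc (CARD('n) - 2)" using CARD_ge_3 by simp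
  have "De (CARD('n) - 1) X p q0 = dE (CARD('n) - 1) J ?L"
    using De_eq_dE[OF assms(1-3)] assms(4) by simp
  also have "\<dots> = dE (Suc (CARD('n) - 2)) J ?L"
    by (rule arg_cong[OF N, of "\<lambda>k. dE k J ?L"])
  also have "\<dots> = (- 1) ^ (CARD('n) - 2) * trace (D ** ?L)"
    unfolding D_def by (rule dE_Suc) simp
  finally show ?thesis
    by (simp only: trace_D_mult[OF fr] D2X_def)
qed

text \<open>The formulas for \<open>De\<close> show that \<open>a\<close> and \<open>b\<close> do not depend on the frame.\<close>

lemma BT_coeffs_eq:
  assumes X: "open U" "p \<in> U" "C2_on U X" "DX X p = J" and fr: "BT_frame J q0 q1 p0 p1"
  shows "BT_coeffs X p q0 =
    (1/2 * p1 (D2X X p q0 q0), p0 (D2X X p q0 q0) + p1 (D2X X p q0 q1))"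
  unfolding BT_coeffs_def X(4)
proof (rule the_equality)
  fix ab
  assume "\<exists>q1 p0 p1. BT_frame J q0 q1 p0 p1 \<and>
    ab = (1/2 * p1 (D2X X p q0 q0), p0 (D2X X p q0 q0) + p1 (D2X X p q0 q1))"
  then obtain q1' p0' p1' where fr': "BT_frame J q0 q1' p0' p1'"
    and ab: "ab = (1/2 * p1' (D2X X p q0 q0), p0' (D2X X p q0 q0) + p1' (D2X X p q0 q1'))" by blast
  have 1: "p1' (D2X X p q0 q0) = p1 (D2X X p q0 q0)"
    using De_CARD[OF X fr] De_CARD[OF X fr'] c2_nonzero by simp
  have "p0' (D2X X p q0 q0) + p1' (D2X X p q0 q1') = p0 (D2X X p q0 q0) + p1 (D2X X p q0 q1)"
    using De_CARD_minus_1[OF X fr] De_CARD_minus_1[OF X fr'] c2_nonzero by (simp add: 1)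
  then show "ab = (1/2 * p1 (D2X X p q0 q0), p0 (D2X X p q0 q0) + p1 (D2X X p q0 q1))"
    by (simp add: ab 1)
qed (use fr in blast)

lemma De_BT_coeffs:
  assumes X: "open U" "p \<in> U" "C2_on U X" "DX X p = J"
  shows "De CARD('n) X p q0 = (- 1) ^ (CARD('n) - 1) * c2 * (2 * fst (BT_coeffs X p q0))"
    and "De (CARD('n) - 1) X p q0 = (- 1) ^ (CARD('n) - 2) *
      (c2 * snd (BT_coeffs X p q0) + c3 * (2 * fst (BT_coeffs X p q0)))"
proof -
  obtain q1 p0 p1 where fr: "BT_frame J q0 q1 p0 p1" using frame_exists by blast
  show "De CARD('n) X p q0 = (- 1) ^ (CARD('n) - 1) * c2 * (2 * fst (BT_coeffs X p q0))"
    by (simp add: De_CARD[OF X fr] BT_coeffs_eq[OF X fr])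
  show "De (CARD('n) - 1) X p q0 = (- 1) ^ (CARD('n) - 2) *
      (c2 * snd (BT_coeffs X p q0) + c3 * (2 * fst (BT_coeffs X p q0)))"
    using De_CARD_minus_1[OF X fr] by (simp add: BT_coeffs_eq[OF X fr])
qed

lemma exists_same_BT_coeffs_different_De:
  assumes X: "open U" "p \<in> U" "C2_on U X" "X p = 0" "DX X p = J"
    and k: "1 \<le> k" "k \<le> CARD('n) - 2"
  shows "\<exists>Y. C2_on U Y \<and> Y p = 0 \<and> DX Y p = J \<and> BT_coeffs Y p q0 = BT_coeffs X p q0 \<and>
    De k Y p q0 \<noteq> De k X p q0"
proof -
  obtain m where m: "k = Suc m" "m + 3 \<le> CARD('n)" using k CARD_ge_3 by (cases k) auto
  obtain N where N: "trace (fl_mat J m ** (J ** J ** N ** J ** J)) \<noteq> 0"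
    using trace_fl_mat_E_tr_nonzero[OF m(2)] by blast
  define M where "M = J ** J ** N ** J ** J"
  define l where "l v = (q0 \<bullet> v) / (q0 \<bullet> q0)" for v
  define \<beta> where "\<beta> u v = l u *\<^sub>R (M *v v) + l v *\<^sub>R (M *v u)" for u v
  have lin: "l (u + v) = l u + l v" "l (c *\<^sub>R u) = c * l u" for u v c
    by (simp_all add: l_def inner_add_right add_divide_distrib)
  have bil: "bilinear \<beta>"
    unfolding bilinear_def \<beta>_def
    by (intro allI conjI linearI) (simp_all add: lin algebra_simps matrix_vector_mult_scaleR)
  have sym: "\<beta> u v = \<beta> v u" for u v by (simp add: \<beta>_def add.commute)
  define Y where "Y x = X x + (1/2) *\<^sub>R \<beta> (x - p) (x - p)" for x
  note Y = quadratic_perturbation[OF X(1-3) bil sym, folded Y_def]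
  have DXY: "DX Y p = J" using Y(3) X(5) by simp
  obtain q1 p0 p1 where fr: "BT_frame J q0 q1 p0 p1" using frame_exists by blast
  have q1: "J *v q1 = q0" using fr by (simp add: BT_frame_def)
  have Mq: "M *v q0 = 0" "M *v q1 = 0"
    by (simp_all add: M_def J_q0 q1 flip: matrix_vector_mul_assoc)
  \<comment> \<open>The pair (a, b) sees the perturbation only in these two values.\<close>
  have "\<beta> q0 q0 = 0" "\<beta> q0 q1 = 0" by (simp_all add: \<beta>_def Mq)
  then have BT: "BT_coeffs Y p q0 = BT_coeffs X p q0"
    by (simp add: BT_coeffs_eq[OF X(1,2,3,5) fr] BT_coeffs_eq[OF X(1,2) Y(1) DXY fr] Y(5))
  have "l q0 = 1" using q0_nonzero by (simp add: l_def)
  \<comment> \<open>Since l q0 = 1 and M q0 = 0, the derivative of DX along q0 changes by exactly M,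
    hence \<open>De k\<close> by the linear gradient at M.\<close>
  then have "\<beta> q0 = (\<lambda>v. M *v v)" by (simp add: \<beta>_def Mq fun_eq_iff)
  then have "De k Y p q0 = dE k J (frechet_derivative (\<lambda>x. DX X x) (at p) q0 + M)"
    by (simp add: De_eq_dE[OF X(1,2) Y(1)] DXY Y(4))
  also have "\<dots> = De k X p q0 + dE k J M"
    by (simp add: linear_add[OF linear_dE] De_eq_dE[OF X(1-3)] X(5))
  finally have "De k Y p q0 = De k X p q0 + dE k J M" .
  moreover have "dE k J M \<noteq> 0"
    using m N by (simp add: dE_Suc M_def)
  ultimately show ?thesis using Y(1,2) X(4) DXY BT by auto
qed

end

section \<open>Nonzero trace forms, and the invariants whose derivatives are determined\<close>

theorem theorem5p7:
  shows "(\<forall>(\<nu>::nat) (A :: 'a::field_char_0 mat).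
            \<nu> \<ge> 1 \<and> A \<in> carrier_mat \<nu> \<nu> \<and> invertible_mat A
            \<longrightarrow> (\<forall>j \<le> \<nu> - 1. adj_coeff A j \<noteq> 0\<^sub>m \<nu> \<nu>))
       \<and>
         (\<forall>(U :: (real^'n) set) X p J q0.
            CARD('n) \<ge> 3 \<and> open U \<and> C2_on U X \<and> p \<in> U \<and> X p = 0 \<and> J = DX X p
            \<and> rank J = CARD('n) - 1
            \<and> e_inv (CARD('n) - 1) J = 0 \<and> e_inv (CARD('n) - 2) J \<noteq> 0
            \<and> span {q0} = mker J
            \<longrightarrow>
              (\<forall>\<rho> bs. 2 \<le> \<rho> \<and> \<rho> \<le> CARD('n) - 1 \<and> basis_list (E_tr J) bs
                 \<longrightarrow> linear_form_on_End (E_tr J) (t_form bs (\<lambda>v. J *v v) (\<rho> - 2))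
                   \<and> (\<exists>M \<in> End_on (E_tr J). t_form bs (\<lambda>v. J *v v) (\<rho> - 2) M \<noteq> 0))
            \<and> (\<forall>k. 1 \<le> k \<and> k \<le> CARD('n) - 2
                 \<longrightarrow> (\<exists>Y. C2_on U Y \<and> Y p = 0 \<and> DX Y p = J
                        \<and> BT_coeffs Y p q0 = BT_coeffs X p q0
                        \<and> De k Y p q0 \<noteq> De k X p q0))
            \<and> {k \<in> {1..CARD('n)}. determined_by_J_ab J k} = {CARD('n) - 1, CARD('n)})"
proof (intro conjI allI impI)
  fix \<nu> :: nat and A :: "'a mat" and j
  assume "\<nu> \<ge> 1 \<and> A \<in> carrier_mat \<nu> \<nu> \<and> invertible_mat A" "j \<le> \<nu> - 1"
  then show "adj_coeff A j \<noteq> 0\<^sub>m \<nu> \<nu>" by (intro adj_coeff_nonzero) auto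
next
  fix U :: "(real^'n) set" and X :: "real^'n \<Rightarrow> real^'n" and p q0 :: "real^'n" and J :: "real^'n^'n"
  let ?N = "CARD('n)"
  assume hyps: "?N \<ge> 3 \<and> open U \<and> C2_on U X \<and> p \<in> U \<and> X p = 0 \<and> J = DX X p
    \<and> rank J = ?N - 1 \<and> e_inv (?N - 1) J = 0 \<and> e_inv (?N - 2) J \<noteq> 0 \<and> span {q0} = mker J"
  then have X: "open U" "p \<in> U" "C2_on U X" "X p = 0" "DX X p = J" by auto
  interpret bt_matrix J q0 by unfold_locales (use hyps in auto)
  {
    fix \<rho> bs assume \<rho>: "2 \<le> \<rho> \<and> \<rho> \<le> ?N - 1 \<and> basis_list (E_tr J) bs"
    then have basis: "basis_list (E_tr J) bs" by blast
    show "linear_form_on_End (E_tr J) (t_form bs (\<lambda>v. J *v v) (\<rho> - 2))"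
      by (rule linear_form_t_form[OF basis])
    obtain G where G: "\<And>v. v \<in> E_tr J \<Longrightarrow> G *v v \<in> E_tr J"
      "\<And>v. v \<in> E_tr J \<Longrightarrow> J *v (G *v v) = v" "\<And>v. v \<in> E_tr J \<Longrightarrow> G *v (J *v v) = v"
      using J_inverse_on_E_trE by blast
    have "J *v v \<in> E_tr J" if "v \<in> E_tr J" for v
    proof -
      from that obtain w where "v = (J ** J) *v w" by (auto simp: E_tr_def)
      then have "J *v v = (J ** J) *v (J *v w)" by (simp add: matrix_vector_mul_assoc matrix_mul_assoc)
      then show ?thesis by (auto simp: E_tr_def)
    qed
    then have "(\<lambda>v. J *v v) \<in> End_on (E_tr J)" "(\<lambda>v. G *v v) \<in> End_on (E_tr J)"
      using G(1) by (auto simp: End_on_def matrix_vector_right_distrib matrix_vector_mult_scaleR)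
    then have inv: "invertible_mat (endo_mat bs (\<lambda>v. J *v v))"
      using G(2,3) by (rule invertible_endo_mat[OF basis])
    have "length bs = dim (E_tr J)"
      using basis_listD[OF basis] dim_eq_card_independent[of "set bs"] dim_span[of "set bs"]
      by (simp add: distinct_card)
    \<comment> \<open>The dimension n - 2 fits the range exactly: \<rho> \<le> n - 1 gives \<rho> -
      2 \<le> n - 3.\<close>
    then have "\<rho> - 2 < length bs"
      using \<rho> CARD_ge_3 by (auto simp: dim_E_tr)
    then show "\<exists>M\<in>End_on (E_tr J). t_form bs (\<lambda>v. J *v v) (\<rho> - 2) M \<noteq> 0"
      by (rule t_form_nonzero[OF basis inv])
  next
    fix k assume "1 \<le> k \<and> k \<le> ?N - 2"
    then show "\<exists>Y. C2_on U Y \<and> Y p = 0 \<and> DX Y p = J \<and> BT_coeffs Y p q0 = BT_coeffs X p q0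
        \<and> De k Y p q0 \<noteq> De k X p q0"
      using exists_same_BT_coeffs_different_De[OF X] by blast
  next
    have "determined_by_J_ab J ?N"
      unfolding determined_by_J_ab_def
    proof (intro exI[of _ "\<lambda>ab. (- 1) ^ (?N - 1) * c2 * (2 * fst ab)"] allI impI)
      fix V Z and r s :: "real^'n"
      assume Z: "open V \<and> C2_on V Z \<and> r \<in> V \<and> Z r = 0 \<and> DX Z r = J \<and> span {s} = mker J"
      \<comment> \<open>Only the spanning vector changes: \<open>c2\<close> depends on J alone, so
        one function of (a, b) serves every s.\<close>
      then interpret s: bt_matrix J s by unfold_locales (use hyps in auto)
      show "De ?N Z r s = (- 1) ^ (?N - 1) * c2 * (2 * fst (BT_coeffs Z r s))"
        using Z by (intro s.De_BT_coeffs) auto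
    qed
    moreover have "determined_by_J_ab J (?N - 1)"
      unfolding determined_by_J_ab_def
    proof (intro exI[of _ "\<lambda>ab. (- 1) ^ (?N - 2) * (c2 * snd ab + c3 * (2 * fst ab))"] allI impI)
      fix V Z and r s :: "real^'n"
      assume Z: "open V \<and> C2_on V Z \<and> r \<in> V \<and> Z r = 0 \<and> DX Z r = J \<and> span {s} = mker J"
      then interpret s: bt_matrix J s by unfold_locales (use hyps in auto)
      show "De (?N - 1) Z r s =
          (- 1) ^ (?N - 2) * (c2 * snd (BT_coeffs Z r s) + c3 * (2 * fst (BT_coeffs Z r s)))"
        using Z by (intro s.De_BT_coeffs) auto
    qed
    moreover have "\<not> determined_by_J_ab J k" if k: "1 \<le> k" "k \<le> ?N - 2" for k
    proof
      assume "determined_by_J_ab J k"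
      then obtain F where F: "\<And>Z. C2_on U Z \<Longrightarrow> Z p = 0 \<Longrightarrow> DX Z p = J \<Longrightarrow> De k Z p q0 = F (BT_coeffs Z p q0)"
        using X(1,2) span_q0 unfolding determined_by_J_ab_def by metis
      obtain Y where "C2_on U Y" "Y p = 0" "DX Y p = J" "BT_coeffs Y p q0 = BT_coeffs X p q0"
        "De k Y p q0 \<noteq> De k X p q0"
        using exists_same_BT_coeffs_different_De[OF X k] by blast
      then show False using F[of Y] F[of X] X by simp
    qed
    ultimately have *: "determined_by_J_ab J ?N" "determined_by_J_ab J (?N - 1)"
      "\<And>k. 1 \<le> k \<Longrightarrow> k \<le> ?N - 2 \<Longrightarrow> \<not> determined_by_J_ab J k" by blast+
    have "determined_by_J_ab J k \<longleftrightarrow> k = ?N - 1 \<or> k = ?N" if "1 \<le> k" "k \<le> ?N" for k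
    proof -
      have "k \<le> ?N - 2 \<or> k = ?N - 1 \<or> k = ?N" using that by linarith
      then show ?thesis using * that by blast
    qed
    then show "{k \<in> {1..?N}. determined_by_J_ab J k} = {?N - 1, ?N}"
      using CARD_ge_3 by auto
  }
qed

end
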